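(* Let $E$ and $F$ be Banach lattices such that the norm of $E'$ is order continuous. Then every positive L-weakly compact operator $T:E\to F$ is disjoint weak$^{\star}$ Dunford-Pettis.
   Context: "Operator" means bounded linear map; $E'$ is the dual of $E$ and $B_E$ its closed unit ball (of $E$). A norm bounded subset $A$ of a Banach lattice $F$ is L-weakly compact if every disjoint sequence in the solid hull of $A$ converges to $0$ in norm. An operator $T:E\to F$ is L-weakly compact if $T(B_E)$ is an L-weakly compact subset of $F$. An operator $T:E\to F$ is disjoint weak$^{\star}$ Dunford-Pettis if $\lim_{n\to\infty} f_n(Tx_n)=0$ for every norm bounded disjoint sequence $(x_n)$ in $E$ and every weak$^{\star}$ null sequence $(f_n)$ in $F'$. *)

theory Defs
  imports "HOL-Analysis.Analysis" "HOL-Library.Lattice_Algebras"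
begin

class banach_lattice = banach + ordered_real_vector + lattice_ab_group_add_abs +
  assumes norm_mono_abs: "\<bar>x\<bar> \<le> \<bar>y\<bar> \<Longrightarrow> norm x \<le> norm y"

instance real :: banach_lattice
  by standard simp

text \<open>
  The dual of a Banach lattice \<open>'a\<close> is \<open>'a \<Rightarrow>\<^sub>L real\<close> with the operator norm and the
  order induced by the cone of positive functionals. Antisymmetry of this order uses
  that the positive cone of the domain is generating.
\<close>

instantiation blinfun ::
  (banach_lattice, "{real_normed_vector, ordered_real_vector}") ordered_real_vector
begin

definition less_eq_blinfun :: "('a \<Rightarrow>\<^sub>L 'b) \<Rightarrow> ('a \<Rightarrow>\<^sub>L 'b) \<Rightarrow> bool" where
  "f \<le> g \<longleftrightarrow> (\<forall>x\<ge>0. blinfun_apply f x \<le> blinfun_apply g x)"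

definition less_blinfun :: "('a \<Rightarrow>\<^sub>L 'b) \<Rightarrow> ('a \<Rightarrow>\<^sub>L 'b) \<Rightarrow> bool" where
  "less_blinfun f g \<longleftrightarrow> f \<le> g \<and> \<not> g \<le> f"

instance
proof
  fix f g h :: "'a \<Rightarrow>\<^sub>L 'b" and a b :: real
  show "f < g \<longleftrightarrow> f \<le> g \<and> \<not> g \<le> f"
    by (rule less_blinfun_def)
  show "f \<le> f"
    by (simp add: less_eq_blinfun_def)
  show "f \<le> g \<Longrightarrow> g \<le> h \<Longrightarrow> f \<le> h"
    unfolding less_eq_blinfun_def by (meson order_trans)
  show "f = g" if "f \<le> g" "g \<le> f"
  proof (rule blinfun_eqI)
    fix x :: 'a
    have pos: "blinfun_apply f y = blinfun_apply g y" if "0 \<le> y" for y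
      using \<open>f \<le> g\<close> \<open>g \<le> f\<close> that by (auto simp: less_eq_blinfun_def intro: antisym)
    have "x = pprt x - (- nprt x)"
      using prts[of x] by simp
    moreover have "0 \<le> pprt x" "0 \<le> - nprt x"
      by simp_all
    ultimately show "blinfun_apply f x = blinfun_apply g x"
      by (metis pos blinfun.diff_right)
  qed
  show "f \<le> g \<Longrightarrow> h + f \<le> h + g"
    by (simp add: less_eq_blinfun_def blinfun.add_left)
  show "f \<le> g \<Longrightarrow> 0 \<le> a \<Longrightarrow> a *\<^sub>R f \<le> a *\<^sub>R g"
    by (simp add: less_eq_blinfun_def blinfun.scaleR_left scaleR_left_mono)
  show "a \<le> b \<Longrightarrow> 0 \<le> f \<Longrightarrow> a *\<^sub>R f \<le> b *\<^sub>R f"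
    by (simp add: less_eq_blinfun_def blinfun.scaleR_left scaleR_right_mono)
qed

end

definition positive_operator :: "('a::banach_lattice \<Rightarrow>\<^sub>L 'b::banach_lattice) \<Rightarrow> bool" where
  "positive_operator T \<longleftrightarrow> (\<forall>x\<ge>0. 0 \<le> blinfun_apply T x)"

text \<open>
  \<open>decreases_to_zero D\<close> says that \<open>D\<close>, regarded as a net indexed by itself, satisfies
  \<open>D \<down> 0\<close>. The range of every decreasing net with infimum 0 is such a set, so
  quantifying over these sets amounts to quantifying over nets with arbitrary index types.
  Only the order and the norm are involved, so that the notion applies to a dual
  \<open>'a \<Rightarrow>\<^sub>L real\<close> without supplying its lattice operations.
\<close>

definition decreases_to_zero :: "'a::{order, zero} set \<Rightarrow> bool" where
  "decreases_to_zero D \<longleftrightarrow>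
     D \<noteq> {} \<and>
     (\<forall>a\<in>D. \<forall>b\<in>D. \<exists>c\<in>D. c \<le> a \<and> c \<le> b) \<and>
     (\<forall>a\<in>D. 0 \<le> a) \<and> (\<forall>l. (\<forall>a\<in>D. l \<le> a) \<longrightarrow> l \<le> 0)"

definition order_continuous_norm :: "'a::{real_normed_vector, order} itself \<Rightarrow> bool" where
  "order_continuous_norm _ \<longleftrightarrow>
     (\<forall>D :: 'a set. decreases_to_zero D \<longrightarrow>
        (\<forall>e>0. \<exists>d\<in>D. \<forall>d'\<in>D. d' \<le> d \<longrightarrow> norm d' < e))"

definition disjoint_seq :: "(nat \<Rightarrow> 'a::banach_lattice) \<Rightarrow> bool" where
  "disjoint_seq x \<longleftrightarrow> (\<forall>m n. m \<noteq> n \<longrightarrow> inf \<bar>x m\<bar> \<bar>x n\<bar> = 0)"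

definition solid_hull :: "'a::banach_lattice set \<Rightarrow> 'a set" where
  "solid_hull A = {y. \<exists>x\<in>A. \<bar>y\<bar> \<le> \<bar>x\<bar>}"

definition L_weakly_compact :: "'a::banach_lattice set \<Rightarrow> bool" where
  "L_weakly_compact A \<longleftrightarrow>
     bounded A \<and>
     (\<forall>y. disjoint_seq y \<and> range y \<subseteq> solid_hull A \<longrightarrow> y \<longlonglongrightarrow> 0)"

definition L_weakly_compact_operator ::
    "('a::banach_lattice \<Rightarrow>\<^sub>L 'b::banach_lattice) \<Rightarrow> bool" where
  "L_weakly_compact_operator T \<longleftrightarrow> L_weakly_compact (blinfun_apply T ` cball 0 1)"

definition weak_star_null :: "(nat \<Rightarrow> 'a::real_normed_vector \<Rightarrow>\<^sub>L real) \<Rightarrow> bool" where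
  "weak_star_null f \<longleftrightarrow> (\<forall>x. (\<lambda>n. blinfun_apply (f n) x) \<longlonglongrightarrow> 0)"

definition disjoint_weak_star_Dunford_Pettis ::
    "('a::banach_lattice \<Rightarrow>\<^sub>L 'b::banach_lattice) \<Rightarrow> bool" where
  "disjoint_weak_star_Dunford_Pettis T \<longleftrightarrow>
     (\<forall>x f. bounded (range x) \<and> disjoint_seq x \<and> weak_star_null f \<longrightarrow>
        (\<lambda>n. blinfun_apply (f n) (blinfun_apply T (x n))) \<longlonglongrightarrow> 0)"

end

theory Submission
  imports Defs
begin

text \<open>
  In fact \<open>T\<close> maps norm bounded disjoint sequences to norm null ones; the claim follows
  because weak* null sequences are norm bounded. By \<open>\<bar>T x\<bar> \<le> T \<bar>x\<bar>\<close> one may take \<open>x\<^sub>n \<ge> 0\<close>.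
  Put \<open>y\<^sub>n = T x\<^sub>n\<close> and suppose \<open>\<delta> \<le> \<parallel>y\<^sub>n\<parallel>\<close> along a subsequence.

  Order continuity of the dual norm gives \<open>\<phi> (y\<^sub>n) \<longlonglongrightarrow> 0\<close> for all positive \<open>\<phi>\<close>: the components
  of \<open>\<phi> \<circ> T\<close> carried by the ideals generated by \<open>x\<^sub>0, \<dots>, x\<^sub>n\<close> increase to a functional and
  hence converge in norm. L-weak compactness of \<open>T\<close> lets one replace \<open>y\<^sub>n\<close>, up to an error \<open>\<delta>/2\<close> and
  along a further subsequence, by \<open>w\<^sub>n = inf y\<^sub>n u\<close> with a fixed \<open>u\<close> in the range of \<open>T\<close>; otherwise
  one could disjointify. Disjoint sequences in \<open>[0, u]\<close> are norm null, so monotone sequences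
  there converge. Choosing positive functionals \<open>\<psi>\<^sub>k\<close> norming \<open>w\<^sub>k\<close> and almost vanishing on
  the later \<open>w\<^sub>m\<close>, the decreasing sequence of the \<open>s\<^sub>k = inf u (\<Sum>m\<ge>k. w\<^sub>m)\<close> has differences bounded
  away from \<open>0\<close>, a contradiction.
\<close>

subsection \<open>Banach lattices\<close>

text \<open>Since \<open>c = sup x c + inf x c - x\<close>, bounds on \<open>sup x c\<close> and
  \<open>inf x c\<close> bound \<open>c\<close>. This is used for \<open>c = a\<close> and
  \<open>c = b\<close>; the resulting bound on \<open>sup a b\<close> rearranges to the
  claim.\<close>

lemma inf_sup_distrib_ab_group:
  fixes x a b :: "'a::lattice_ab_group_add"
  shows "inf x (sup a b) = sup (inf x a) (inf x b)"
proof (rule antisym)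
  define s where "s = sup (inf x a) (inf x b)"
  define t where "t = s + sup x (sup a b) - x"
  have *: "c \<le> t" if "inf x c \<le> s" "c \<le> sup a b" for c
  proof -
    have "c = sup x c + inf x c - x"
      using add_eq_inf_sup[of x c] by (simp add: algebra_simps)
    also have "\<dots> \<le> sup x (sup a b) + s - x"
      using that by (intro diff_right_mono add_mono sup_mono) auto
    finally show ?thesis by (simp add: t_def algebra_simps)
  qed
  have "sup a b \<le> t"
    by (intro sup_least *) (auto simp: s_def)
  then have "x + sup a b - sup x (sup a b) \<le> s"
    unfolding t_def by (simp only: algebra_simps)
  moreover have "inf x (sup a b) = x + sup a b - sup x (sup a b)"
    using add_eq_inf_sup[of x "sup a b"] by (simp only: algebra_simps)
  ultimately show "inf x (sup a b) \<le> sup (inf x a) (inf x b)"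
    by (simp only: s_def)
qed (auto intro: inf_mono le_infI2)

text \<open>A sum of two infima is the infimum of the four pairwise sums, and by positivity each of
  these lies above \<open>x + y\<close> or above \<open>g\<close>.\<close>

lemma inf_add_le:
  fixes x y g :: "'a::lattice_ab_group_add"
  assumes "0 \<le> x" "0 \<le> y" "0 \<le> g"
  shows "inf (x + y) g \<le> inf x g + inf y g"
proof -
  have "inf x g + inf y g = inf (inf (x + y) (g + y)) (inf (x + g) (g + g))"
    by (simp only: add_inf_distrib_left add_inf_distrib_right inf_aci)
  moreover have "inf (x + y) g \<le> \<dots>"
  proof (intro inf_greatest)
    show "inf (x + y) g \<le> x + y" by simp
    show "inf (x + y) g \<le> g + y" "inf (x + y) g \<le> x + g" "inf (x + y) g \<le> g + g"
      using assms by (auto intro: le_infI2 simp: add_increasing add_increasing2)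
  qed
  ultimately show ?thesis by simp
qed

lemma inf_sup_minus_eq_0:
  fixes x :: "'a::lattice_ab_group_add"
  shows "inf (sup x 0) (sup (- x) 0) = 0"
proof -
  have "sup x 0 = x + sup (- x) 0"
    by (simp add: add_sup_distrib_left sup_commute)
  then have "inf (sup x 0) (sup (- x) 0) = inf (x + sup (- x) 0) (0 + sup (- x) 0)"
    by simp
  also have "\<dots> = inf x 0 + sup (- x) 0"
    by (rule add_inf_distrib_right[symmetric])
  also have "\<dots> = 0"
    unfolding inf_eq_neg_sup[of x 0] minus_zero by (rule left_minus)
  finally show ?thesis .
qed

lemma scaleR_inf:
  fixes a b :: "'a::banach_lattice"
  assumes "0 \<le> c"
  shows "c *\<^sub>R inf a b = inf (c *\<^sub>R a) (c *\<^sub>R b)"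
proof (cases "c = 0")
  case False
  with assms have "0 < c" by simp
  show ?thesis
  proof (rule antisym)
    show "c *\<^sub>R inf a b \<le> inf (c *\<^sub>R a) (c *\<^sub>R b)"
      using assms by (auto intro: scaleR_left_mono)
    have "inverse c *\<^sub>R inf (c *\<^sub>R a) (c *\<^sub>R b) \<le> inf a b"
      using \<open>0 < c\<close> by (auto simp: pos_divideR_le_eq intro!: le_infI1 le_infI2
          simp flip: divideR_right)
    then have "c *\<^sub>R inverse c *\<^sub>R inf (c *\<^sub>R a) (c *\<^sub>R b) \<le> c *\<^sub>R inf a b"
      using assms by (rule scaleR_left_mono)
    then show "inf (c *\<^sub>R a) (c *\<^sub>R b) \<le> c *\<^sub>R inf a b"
      using \<open>0 < c\<close> by simp
  qed
qed simp

lemma scaleR_sup: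
  fixes a b :: "'a::banach_lattice"
  assumes "0 \<le> c"
  shows "c *\<^sub>R sup a b = sup (c *\<^sub>R a) (c *\<^sub>R b)"
proof -
  have "- (c *\<^sub>R sup a b) = c *\<^sub>R inf (- a) (- b)"
    by (simp only: neg_sup_eq_inf scaleR_minus_right[symmetric])
  also have "\<dots> = - sup (c *\<^sub>R a) (c *\<^sub>R b)"
    by (simp only: scaleR_inf[OF assms] neg_sup_eq_inf scaleR_minus_right)
  finally show ?thesis by (rule neg_equal_iff_equal[THEN iffD1])
qed

lemma norm_mono:
  fixes x y :: "'a::banach_lattice"
  shows "0 \<le> x \<Longrightarrow> x \<le> y \<Longrightarrow> norm x \<le> norm y"
  by (rule norm_mono_abs) simp

lemma norm_abs [simp]: "norm \<bar>x\<bar> = norm (x::'a::banach_lattice)"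
  by (intro antisym norm_mono_abs) simp_all

lemma norm_sup_zero_le: "norm (sup x 0) \<le> norm (x::'a::banach_lattice)"
proof -
  have "norm (sup x 0) \<le> norm \<bar>x\<bar>"
    by (rule norm_mono) (auto simp: abs_ge_self)
  then show ?thesis by simp
qed

text \<open>If \<open>0 \<le> z n\<close>, the negative part \<open>sup (- l) 0\<close> of the limit
  lies below \<open>sup (z n - l) 0\<close>, whose norm tends to \<open>0\<close>.\<close>

lemma tendsto_nonneg_banach_lattice:
  fixes z :: "nat \<Rightarrow> 'a::banach_lattice"
  assumes "z \<longlonglongrightarrow> l" "eventually (\<lambda>n. 0 \<le> z n) sequentially"
  shows "0 \<le> l"
proof -
  have "(\<lambda>n. norm (z n - l)) \<longlonglongrightarrow> 0"
    using assms(1) LIM_zero tendsto_norm_zero by blast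
  moreover have "\<forall>\<^sub>F n in sequentially. norm (sup (- l) 0) \<le> norm (z n - l)"
    using assms(2)
  proof eventually_elim
    case (elim n)
    have "norm (sup (- l) 0) \<le> norm (sup (z n - l) 0)"
      using elim by (intro norm_mono sup_mono) auto
    also have "\<dots> \<le> norm (z n - l)"
      by (rule norm_sup_zero_le)
    finally show ?case .
  qed
  ultimately have "norm (sup (- l) 0) \<le> 0"
    by (intro tendsto_lowerbound) auto
  then have "sup (- l) 0 = 0" by simp
  then have "- l \<le> 0" by (metis sup_ge1)
  then show ?thesis by simp
qed

lemma tendsto_mono_banach_lattice:
  fixes y z :: "nat \<Rightarrow> 'a::banach_lattice"
  assumes "y \<longlonglongrightarrow> k" "z \<longlonglongrightarrow> l" "eventually (\<lambda>n. y n \<le> z n) sequentially"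
  shows "k \<le> l"
  using tendsto_nonneg_banach_lattice[OF tendsto_diff[OF assms(2,1)]] assms(3) by simp

section \<open>Disjoint positive elements\<close>

lemma disjoint_mono:
  fixes a b c d :: "'a::{lattice_ab_group_add}"
  assumes "0 \<le> a" "a \<le> c" "0 \<le> b" "b \<le> d" "inf c d = 0"
  shows "inf a b = 0"
proof (rule antisym)
  show "inf a b \<le> 0" using inf_mono[OF assms(2,4)] assms(5) by simp
qed (use assms in auto)

lemma disjoint_scaleR:
  fixes a b :: "'a::banach_lattice"
  assumes "inf a b = 0" "0 \<le> a" "0 \<le> b" "0 \<le> r" "0 \<le> s"
  shows "inf (r *\<^sub>R a) (s *\<^sub>R b) = 0"
proof (rule disjoint_mono)
  show "r *\<^sub>R a \<le> max r s *\<^sub>R a" "s *\<^sub>R b \<le> max r s *\<^sub>R b"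
    using assms by (auto intro!: scaleR_right_mono)
  show "inf (max r s *\<^sub>R a) (max r s *\<^sub>R b) = 0"
    using assms by (subst scaleR_inf[symmetric]) auto
qed (use assms in \<open>auto intro: scaleR_nonneg_nonneg\<close>)

lemma disjoint_sum:
  fixes a :: "'a::lattice_ab_group_add"
  assumes "finite I" "0 \<le> a" "\<And>i. i \<in> I \<Longrightarrow> 0 \<le> b i" "\<And>i. i \<in> I \<Longrightarrow> inf a (b i) = 0"
  shows "inf a (sum b I) = 0"
  using assms
proof (induction I rule: finite_induct)
  case empty
  then show ?case by (simp add: inf_absorb2)
next
  case (insert i I)
  have nn: "0 \<le> sum b I" "0 \<le> b i"
    using insert.prems by (auto intro: sum_nonneg)
  have "inf (b i + sum b I) a \<le> inf (b i) a + inf (sum b I) a"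
    using insert.prems nn by (intro inf_add_le) auto
  also have "\<dots> = 0"
    using insert by (simp add: inf_commute)
  finally have "inf (b i + sum b I) a \<le> 0" .
  moreover have "0 \<le> inf (b i + sum b I) a"
    using nn insert.prems by auto
  ultimately show ?case
    using insert.hyps by (metis sum.insert inf_commute antisym)
qed

subsection \<open>Monotone sequences in order intervals\<close>

text \<open>For real functions, \<open>e i\<close> is pointwise the depth at which the level
  \<open>i h\<close> sits inside the interval \<open>[p, q]\<close>, and the level nearest to the
  midpoint has depth at least \<open>(q - p - h) / 2\<close>. A vector lattice offers no choice of
  \<open>i\<close> at each point, so all levels are summed.\<close>

lemma diff_le_level_sum:
  fixes p q h :: "'a::banach_lattice"
  assumes "0 \<le> p" "p \<le> q" "q \<le> real M *\<^sub>R h" "0 \<le> h"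
  defines "e \<equiv> \<lambda>i. inf (sup (q - real i *\<^sub>R h) 0) (sup (real i *\<^sub>R h - p) 0)"
  shows "q - p \<le> h + 2 *\<^sub>R (\<Sum>i\<le>M. e i)"
proof -
  have e_nonneg: "0 \<le> e i" for i
    unfolding e_def by (intro inf_greatest sup_ge2)
  \<comment> \<open>from \<open>2 inf a b = a + b - \<bar>a - b\<bar>\<close>\<close>
  have e_ge: "q - p - \<bar>p + q - (2 * real i) *\<^sub>R h\<bar> \<le> 2 *\<^sub>R e i" for i
  proof -
    define m where "m = p + q - (2 * real i) *\<^sub>R h"
    have "q - p - \<bar>m\<bar> \<le> 2 *\<^sub>R (q - real i *\<^sub>R h)"
         "q - p - \<bar>m\<bar> \<le> 2 *\<^sub>R (real i *\<^sub>R h - p)"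
      using abs_ge_minus_self[of m] abs_ge_self[of m]
      by (simp_all add: m_def algebra_simps scaleR_2 flip: scaleR_scaleR)
    then have "q - p - \<bar>m\<bar> \<le> inf (2 *\<^sub>R (q - real i *\<^sub>R h)) (2 *\<^sub>R (real i *\<^sub>R h - p))"
      by simp
    also have "\<dots> = 2 *\<^sub>R inf (q - real i *\<^sub>R h) (real i *\<^sub>R h - p)"
      by (simp add: scaleR_inf)
    also have "\<dots> \<le> 2 *\<^sub>R e i"
      unfolding e_def by (intro scaleR_left_mono inf_mono sup_ge1) auto
    finally show ?thesis by (simp add: m_def)
  qed
  \<comment> \<open>After the levels up to \<open>j\<close>, an excess over \<open>h\<close> can
    survive only where the midpoint of \<open>p\<close> and \<open>q\<close> lies above level
    \<open>j\<close>; for \<open>j = M\<close> this is ruled out by the upper bound on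
    \<open>q\<close>.\<close>
  have "q - p - 2 *\<^sub>R (\<Sum>i\<le>j. e i) \<le> sup h (p + q - (2 * real j) *\<^sub>R h)" for j
  proof (induction j)
    case 0
    have "q - p - 2 *\<^sub>R e 0 \<le> q - p"
      using scaleR_nonneg_nonneg[OF _ e_nonneg[of 0], of 2] by simp
    also have "\<dots> \<le> q + p"
      using add_mono[OF assms(1,1)] by (simp add: algebra_simps)
    finally have "q - p - 2 *\<^sub>R e 0 \<le> p + q"
      by (simp only: add.commute)
    then show ?case by (simp add: le_supI2)
  next
    case (Suc j)
    define v where "v = p + q - (2 * real j) *\<^sub>R h"
    define R where "R = q - p - 2 *\<^sub>R (\<Sum>i\<le>Suc j. e i)"
    have shift: "p + q - (2 * real (Suc j)) *\<^sub>R h = v - 2 *\<^sub>R h"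
      by (simp add: v_def algebra_simps)
    have "R \<le> q - p - 2 *\<^sub>R (\<Sum>i\<le>j. e i)"
      using scaleR_nonneg_nonneg[OF _ e_nonneg[of "Suc j"], of 2]
      by (simp add: R_def scaleR_add_right diff_diff_eq[symmetric])
    with Suc have R1: "R \<le> sup h v"
      unfolding v_def by (rule order_trans[rotated])
    have "R \<le> q - p - 2 *\<^sub>R e (Suc j)"
      using scaleR_nonneg_nonneg[OF _ sum_nonneg[of "{..j}" e], of 2] e_nonneg
      by (simp add: R_def scaleR_add_right)
    also have "\<dots> \<le> \<bar>v - 2 *\<^sub>R h\<bar>"
      using e_ge[of "Suc j"] unfolding shift by (simp only: diff_le_eq add.commute)
    finally have R2: "R \<le> sup (v - 2 *\<^sub>R h) (2 *\<^sub>R h - v)"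
      by (simp add: abs_lattice)
    \<comment> \<open>After expanding by distributivity, every piece lies below \<open>h\<close> or
      below \<open>v - 2 *\<^sub>R h\<close>. The piece \<open>inf (2 *\<^sub>R h - v) v\<close> is
      at most half the sum of its arguments, which is \<open>h\<close>.\<close>
    have "R \<le> inf (sup h v) (sup (v - 2 *\<^sub>R h) (2 *\<^sub>R h - v))"
      using R1 R2 by (rule inf_greatest)
    also have "\<dots> = sup (inf (sup h v) (v - 2 *\<^sub>R h)) (inf (sup h v) (2 *\<^sub>R h - v))"
      by (rule inf_sup_distrib_ab_group)
    also have "inf (sup h v) (2 *\<^sub>R h - v) = sup (inf (2 *\<^sub>R h - v) h) (inf (2 *\<^sub>R h - v) v)"
      by (subst inf_commute) (rule inf_sup_distrib_ab_group)
    also have "inf (2 *\<^sub>R h - v) v \<le> h"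
    proof -
      have "inf (2 *\<^sub>R h - v) v + inf (2 *\<^sub>R h - v) v \<le> (2 *\<^sub>R h - v) + v"
        by (rule add_mono) auto
      then have "2 *\<^sub>R inf (2 *\<^sub>R h - v) v \<le> 2 *\<^sub>R h"
        by (simp add: scaleR_2)
      then show ?thesis
        by (simp add: scaleR_le_cancel_left_pos)
    qed
    finally show ?case
      unfolding R_def[symmetric] shift
      by (rule order_trans)
        (auto intro: le_infI2 le_supI1 le_supI2 sup_mono)
  qed
  from this[of M] have "q - p - 2 *\<^sub>R (\<Sum>i\<le>M. e i) \<le> sup h (p + q - (2 * real M) *\<^sub>R h)" .
  moreover have "p + q - (2 * real M) *\<^sub>R h \<le> h"
  proof -
    have "p + q \<le> real M *\<^sub>R h + real M *\<^sub>R h"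
      using assms by (intro add_mono) auto
    then have "p + q \<le> (2 * real M) *\<^sub>R h"
      by (simp add: algebra_simps flip: scaleR_add_left)
    then show ?thesis
      using assms(4) by (simp add: add_increasing algebra_simps)
  qed
  ultimately show ?thesis
    by (simp add: sup_absorb1 algebra_simps)
qed

text \<open>For fixed \<open>M\<close>, the level estimate with \<open>h = u / M\<close> bounds the
  norm of the increment by \<open>norm u / M\<close> plus twice the norms of finitely many
  \<open>e (i / M) n\<close>. Each level yields a disjoint sequence in \<open>[0, u]\<close>, hence
  a null one, and \<open>M\<close> is arbitrary.\<close>

lemma incseq_diff_tendsto_zero:
  fixes v :: "nat \<Rightarrow> 'a::banach_lattice"
  assumes "incseq v" "\<And>n. 0 \<le> v n" "\<And>n. v n \<le> u"
    and disj: "\<And>e. disjoint_seq e \<Longrightarrow> (\<And>n. 0 \<le> e n \<and> e n \<le> u) \<Longrightarrow> e \<longlonglongrightarrow> 0"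
  shows "(\<lambda>n. v (Suc n) - v n) \<longlonglongrightarrow> 0"
proof -
  have u: "0 \<le> u" using assms(2,3) order_trans by blast
  define e where "e c n = inf (sup (v (Suc n) - c *\<^sub>R u) 0) (sup (c *\<^sub>R u - v n) 0)" for c n
  have e_nonneg: "0 \<le> e c n" for c n
    unfolding e_def by (intro inf_greatest sup_ge2)
  \<comment> \<open>an increasing sequence crosses each level at most once\<close>
  have "disjoint_seq (e c)" for c
  proof -
    have less: "inf (e c m) (e c n) = 0" if "m < n" for m n
    proof (rule disjoint_mono)
      show "e c m \<le> sup (v (Suc m) - c *\<^sub>R u) 0" by (simp add: e_def)
      have "e c n \<le> sup (c *\<^sub>R u - v n) 0" by (simp add: e_def)
      also have "\<dots> \<le> sup (- (v (Suc m) - c *\<^sub>R u)) 0"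
        using incseqD[OF assms(1), of "Suc m" n] that by (intro sup_mono) auto
      finally show "e c n \<le> sup (- (v (Suc m) - c *\<^sub>R u)) 0" .
    qed (rule e_nonneg inf_sup_minus_eq_0)+
    then show ?thesis
      unfolding disjoint_seq_def
      using e_nonneg by (metis abs_of_nonneg inf_commute linorder_neqE_nat)
  qed
  moreover have "e c n \<le> u" if "0 \<le> c" for c n
  proof -
    have "sup (v (Suc n) - c *\<^sub>R u) 0 \<le> u"
      using assms(3)[of "Suc n"] u that
      by (intro sup_least) (auto simp: diff_le_eq scaleR_nonneg_nonneg add_increasing2)
    then show ?thesis by (simp add: e_def le_infI1)
  qed
  ultimately have e_lim: "e c \<longlonglongrightarrow> 0" if "0 \<le> c" for c
    using that e_nonneg by (intro disj) auto
  have bound: "norm (v (Suc n) - v n) \<le> norm u / M + 2 * (\<Sum>i\<le>M. norm (e (real i / M) n))"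
    if "0 < M" for M n
  proof -
    have "v (Suc n) - v n \<le> (1 / M) *\<^sub>R u + 2 *\<^sub>R (\<Sum>i\<le>M. e (real i / M) n)"
      using diff_le_level_sum[of "v n" "v (Suc n)" M "(1 / M) *\<^sub>R u"] that assms(2,3) u
        incseqD[OF assms(1), of n "Suc n"]
      by (simp add: e_def scaleR_nonneg_nonneg)
    then have "norm (v (Suc n) - v n) \<le> norm ((1 / M) *\<^sub>R u + 2 *\<^sub>R (\<Sum>i\<le>M. e (real i / M) n))"
      using incseqD[OF assms(1), of n "Suc n"] by (intro norm_mono) auto
    also have "\<dots> \<le> norm u / M + 2 * norm (\<Sum>i\<le>M. e (real i / M) n)"
      by (rule order_trans[OF norm_triangle_ineq]) simp
    also have "norm (\<Sum>i\<le>M. e (real i / M) n) \<le> (\<Sum>i\<le>M. norm (e (real i / M) n))"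
      by (rule norm_sum)
    finally show ?thesis by simp
  qed
  show ?thesis
  proof (rule LIMSEQ_I)
    fix r :: real assume "0 < r"
    obtain M :: nat where M: "0 < M" "norm u / M < r / 2"
    proof -
      obtain M :: nat where "norm u * 2 / r < M" using reals_Archimedean2 by blast
      then have "norm u / (Suc M) < r / 2"
        using \<open>0 < r\<close> by (simp add: field_simps)
      then show ?thesis using that by blast
    qed
    have "(\<lambda>n. 2 * (\<Sum>i\<le>M. norm (e (real i / M) n))) \<longlonglongrightarrow> 2 * (\<Sum>i\<le>M. 0)"
      by (intro tendsto_mult tendsto_sum tendsto_const tendsto_norm_zero e_lim) simp
    moreover have "2 * (\<Sum>i\<le>M. 0) < r / 2"
      using \<open>0 < r\<close> by simp
    ultimately have "\<forall>\<^sub>F n in sequentially. 2 * (\<Sum>i\<le>M. norm (e (real i / M) n)) < r / 2"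
      by (rule order_tendstoD(2))
    then obtain N where "\<And>n. n \<ge> N \<Longrightarrow> 2 * (\<Sum>i\<le>M. norm (e (real i / M) n)) < r / 2"
      by (auto simp: eventually_sequentially)
    then show "\<exists>N. \<forall>n\<ge>N. norm (v (Suc n) - v n - 0) < r"
      using bound[OF M(1)] M(2) by (smt (verit) diff_zero field_sum_of_halves)
  qed
qed

text \<open>Otherwise some subsequence has all consecutive gaps at least a fixed
  \<open>\<epsilon> > 0\<close> in norm, although its increments tend to \<open>0\<close>.\<close>

lemma incseq_Cauchy:
  fixes v :: "nat \<Rightarrow> 'a::banach_lattice"
  assumes "incseq v" "\<And>n. 0 \<le> v n" "\<And>n. v n \<le> u"
    and disj: "\<And>e. disjoint_seq e \<Longrightarrow> (\<And>n. 0 \<le> e n \<and> e n \<le> u) \<Longrightarrow> e \<longlonglongrightarrow> 0"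
  shows "Cauchy v"
proof (rule ccontr)
  assume "\<not> Cauchy v"
  then obtain \<epsilon> where \<epsilon>: "0 < \<epsilon>" "\<And>M. \<exists>m\<ge>M. \<exists>n\<ge>M. \<epsilon> \<le> norm (v m - v n)"
    unfolding Cauchy_iff by (meson linorder_not_le)
  \<comment> \<open>Lowering the smaller index to \<open>M\<close> only enlarges a difference of an
    increasing sequence, so a gap can be made to start exactly at \<open>M\<close> and the choice
    can be iterated.\<close>
  have gap: "\<exists>n>M. \<epsilon> \<le> norm (v n - v M)" for M
  proof -
    have *: "\<epsilon> \<le> norm (v n - v M) \<and> M < n" if "M \<le> m" "m \<le> n" "\<epsilon> \<le> norm (v n - v m)" for m n
    proof -
      have "norm (v n - v m) \<le> norm (v n - v M)"
        using that assms(1) by (intro norm_mono) (auto simp: incseq_def)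
      moreover have "M \<noteq> n"
      proof
        assume "M = n"
        with that have "m = n" by simp
        then show False using that(3) \<epsilon>(1) by simp
      qed
      ultimately show ?thesis using that by linarith
    qed
    obtain m n where "m \<ge> M" "n \<ge> M" "\<epsilon> \<le> norm (v m - v n)" using \<epsilon>(2) by blast
    then show ?thesis
      using *[of n m] *[of m n] norm_minus_commute[of "v m" "v n"] nle_le[of m n] by metis
  qed
  have "\<exists>r. \<forall>n. True \<and> (r n < r (Suc n) \<and> \<epsilon> \<le> norm (v (r (Suc n)) - v (r n)))"
    using gap by (intro dependent_nat_choice) auto
  then obtain r :: "nat \<Rightarrow> nat" where r: "\<And>n. r n < r (Suc n)" "\<And>n. \<epsilon> \<le> norm (v (r (Suc n)) - v (r n))"
    by auto
  have "(\<lambda>n. (v \<circ> r) (Suc n) - (v \<circ> r) n) \<longlonglongrightarrow> 0"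
  proof (rule incseq_diff_tendsto_zero)
    show "incseq (v \<circ> r)"
      using assms(1) r(1) by (intro incseq_SucI) (auto simp: incseq_def less_imp_le)
  qed (use assms in auto)
  then have "(\<lambda>n. norm (v (r (Suc n)) - v (r n))) \<longlonglongrightarrow> 0"
    by (auto intro: tendsto_norm_zero)
  then have "\<epsilon> \<le> 0"
    by (rule tendsto_lowerbound) (use r in auto)
  with \<epsilon>(1) show False by simp
qed

subsection \<open>Sublinear functionals and norm bounds\<close>

definition sublinear :: "('a::real_vector \<Rightarrow> real) \<Rightarrow> bool" where
  "sublinear p \<longleftrightarrow> (\<forall>x y. p (x + y) \<le> p x + p y) \<and> (\<forall>c\<ge>0. \<forall>x. p (c *\<^sub>R x) \<le> c * p x)"

lemma sublinear_zero:
  assumes "sublinear p"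
  shows "p 0 = 0"
proof -
  have "p (0 + 0) \<le> p 0 + p 0" "p (0 *\<^sub>R 0) \<le> 0 * p 0"
    using assms unfolding sublinear_def by blast+
  then show ?thesis by simp
qed

lemma sublinear_scaleR:
  assumes "sublinear p" "0 \<le> c"
  shows "p (c *\<^sub>R x) = c * p x"
proof (cases "c = 0")
  case False
  with assms have "0 < c" by simp
  have "p (inverse c *\<^sub>R c *\<^sub>R x) \<le> inverse c * p (c *\<^sub>R x)"
    using assms(1) \<open>0 < c\<close> unfolding sublinear_def by (meson inverse_nonnegative_iff_nonnegative less_imp_le)
  then have "c * p x \<le> p (c *\<^sub>R x)"
    using \<open>0 < c\<close> by (simp add: field_simps)
  moreover have "p (c *\<^sub>R x) \<le> c * p x"
    using assms unfolding sublinear_def by blast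
  ultimately show ?thesis by simp
qed (use sublinear_zero[OF assms(1)] in simp)

lemma sublinear_minus:
  assumes "sublinear p"
  shows "- p (- x) \<le> p x"
proof -
  have "p (x + - x) \<le> p x + p (- x)"
    using assms unfolding sublinear_def by blast
  then show ?thesis using sublinear_zero[OF assms] by simp
qed

section \<open>The Hahn-Banach theorem through minimal sublinear functionals\<close>

text \<open>The tilt lies below \<open>p\<close> (take \<open>t = 0\<close>) and is at most
  \<open>- p y\<close> at \<open>- y\<close> (take \<open>t = 1\<close>), so every linear functional
  below it is at least \<open>p y\<close> at \<open>y\<close>.\<close>

lemma sublinear_tilt:
  fixes p :: "'a::real_vector \<Rightarrow> real" and y :: 'a
  assumes "sublinear p"
  defines "q \<equiv> \<lambda>x. INF t\<in>{0..}. p (x + t *\<^sub>R y) - t * p y"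
  shows "sublinear q" and "0 \<le> t \<Longrightarrow> q x \<le> p (x + t *\<^sub>R y) - t * p y"
proof -
  have add: "p (u + v) \<le> p u + p v" for u v
    using assms(1) by (simp add: sublinear_def)
  have bdd: "bdd_below ((\<lambda>t. p (x + t *\<^sub>R y) - t * p y) ` {0..})" for x
  proof (rule bdd_belowI2)
    fix t :: real assume "t \<in> {0..}"
    then show "- p (- x) \<le> p (x + t *\<^sub>R y) - t * p y"
      using add[of "x + t *\<^sub>R y" "- x"] sublinear_scaleR[OF assms(1), of t y] by simp
  qed
  show le: "q x \<le> p (x + t *\<^sub>R y) - t * p y" if "0 \<le> t" for x t
    unfolding q_def using that by (intro cINF_lower[OF bdd]) simp
  have ge: "c \<le> q x" if "\<And>t. 0 \<le> t \<Longrightarrow> c \<le> p (x + t *\<^sub>R y) - t * p y" for c x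
    unfolding q_def using that by (intro cINF_greatest) auto
  show "sublinear q"
    unfolding sublinear_def
  proof (intro conjI allI impI)
    fix u v
    have "q (u + v) - (p (v + s *\<^sub>R y) - s * p y) \<le> q u" if "0 \<le> s" for s
    proof (rule ge)
      fix t :: real assume "0 \<le> t"
      then have "q (u + v) \<le> p (u + v + (t + s) *\<^sub>R y) - (t + s) * p y"
        using that by (intro le) simp
      also have "u + v + (t + s) *\<^sub>R y = (u + t *\<^sub>R y) + (v + s *\<^sub>R y)"
        by (simp add: algebra_simps)
      finally show "q (u + v) - (p (v + s *\<^sub>R y) - s * p y) \<le> p (u + t *\<^sub>R y) - t * p y"
        using add[of "u + t *\<^sub>R y" "v + s *\<^sub>R y"] by (simp add: algebra_simps)
    qed
    then have "q (u + v) - q u \<le> q v"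
      by (intro ge) (simp add: algebra_simps)
    then show "q (u + v) \<le> q u + q v" by simp
  next
    fix c :: real and x assume c: "0 \<le> c"
    show "q (c *\<^sub>R x) \<le> c * q x"
    proof (cases "c = 0")
      case True
      then show ?thesis using le[of 0 0] sublinear_zero[OF assms(1)] by simp
    next
      case False
      have "q (c *\<^sub>R x) / c \<le> q x"
      proof (rule ge)
        fix t :: real assume t: "0 \<le> t"
        have "q (c *\<^sub>R x) \<le> p (c *\<^sub>R x + (c * t) *\<^sub>R y) - (c * t) * p y"
          using c t by (intro le) simp
        also have "c *\<^sub>R x + (c * t) *\<^sub>R y = c *\<^sub>R (x + t *\<^sub>R y)"
          by (simp add: algebra_simps)
        finally have "q (c *\<^sub>R x) \<le> (p (x + t *\<^sub>R y) - t * p y) * c"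
          unfolding sublinear_scaleR[OF assms(1) c] by (simp add: algebra_simps)
        then show "q (c *\<^sub>R x) / c \<le> p (x + t *\<^sub>R y) - t * p y"
          using c False by (simp add: pos_divide_le_eq)
      qed
      then show ?thesis using c False by (simp add: pos_divide_le_eq mult.commute)
    qed
  qed
qed

text \<open>This supplies the bounds of chains for Zorn's lemma. The infimum is finite because
  \<open>q x\<close> is at least \<open>- q (- x)\<close> and hence at least
  \<open>- p (- x)\<close>. Comparability gives subadditivity, since two members can be replaced by
  the smaller one.\<close>

lemma sublinear_chain_Inf:
  fixes C :: "('a::real_vector \<Rightarrow> real) set"
  assumes "C \<noteq> {}" "\<And>q. q \<in> C \<Longrightarrow> sublinear q \<and> q \<le> p"
    and chain: "\<And>q r. q \<in> C \<Longrightarrow> r \<in> C \<Longrightarrow> q \<le> r \<or> r \<le> q"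
  defines "u \<equiv> \<lambda>x. INF q\<in>C. q x"
  shows "sublinear u" and "q \<in> C \<Longrightarrow> u \<le> q"
proof -
  have bdd: "bdd_below ((\<lambda>q. q x) ` C)" for x
  proof (rule bdd_belowI2)
    fix q assume "q \<in> C"
    then have "- q (- x) \<le> q x" "q (- x) \<le> p (- x)"
      using assms(2)[of q] sublinear_minus by (auto simp: le_fun_def)
    then show "- p (- x) \<le> q x" by simp
  qed
  have le: "u x \<le> q x" if "q \<in> C" for q x
    unfolding u_def using that by (intro cINF_lower[OF bdd]) simp
  then show "q \<in> C \<Longrightarrow> u \<le> q" for q
    by (simp add: le_fun_def)
  have ge: "c \<le> u x" if "\<And>q. q \<in> C \<Longrightarrow> c \<le> q x" for c x
    unfolding u_def using that assms(1) by (intro cINF_greatest) auto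
  show "sublinear u"
    unfolding sublinear_def
  proof (intro conjI allI impI)
    fix x y
    have "u (x + y) - r y \<le> u x" if r: "r \<in> C" for r
    proof (rule ge)
      fix q assume "q \<in> C"
      obtain s where s: "s \<in> C" "s \<le> q" "s \<le> r"
        using chain[OF \<open>q \<in> C\<close> r] \<open>q \<in> C\<close> r by (metis order_refl)
      have "u (x + y) \<le> s (x + y)" using s(1) by (rule le)
      also have "\<dots> \<le> s x + s y" using assms(2)[OF s(1)] by (simp add: sublinear_def)
      also have "\<dots> \<le> q x + r y" using s by (intro add_mono) (auto simp: le_fun_def)
      finally show "u (x + y) - r y \<le> q x" by simp
    qed
    then have "u (x + y) - u x \<le> u y"
      by (intro ge) (simp add: algebra_simps)
    then show "u (x + y) \<le> u x + u y" by simp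
  next
    fix c :: real and x assume c: "0 \<le> c"
    show "u (c *\<^sub>R x) \<le> c * u x"
    proof (cases "c = 0")
      case True
      obtain q where "q \<in> C" using assms(1) by blast
      then show ?thesis using True le[of q 0] assms(2)[of q] sublinear_zero[of q] by simp
    next
      case False
      have "u (c *\<^sub>R x) / c \<le> u x"
      proof (rule ge)
        fix q assume "q \<in> C"
        then show "u (c *\<^sub>R x) / c \<le> q x"
          using le[of q "c *\<^sub>R x"] sublinear_scaleR[of q c x] assms(2)[of q] c False
          by (simp add: pos_divide_le_eq mult.commute)
      qed
      then show ?thesis using c False by (simp add: pos_divide_le_eq mult.commute)
    qed
  qed
qed

text \<open>A minimal sublinear functional is linear, and Zorn's lemma for the reversed order gives
  one below \<open>p\<close>.\<close>

lemma sublinear_dominates_linear: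
  fixes p :: "'a::real_vector \<Rightarrow> real"
  assumes "sublinear p"
  obtains f where "linear f" "\<And>x. f x \<le> p x"
proof -
  define A where "A = {q. sublinear q \<and> q \<le> p}"
  have "\<exists>m\<in>A. \<forall>q\<in>A. q \<le> m \<longrightarrow> q = m"
  proof (rule predicate_Zorn)
    show "partial_order_on A (relation_of (\<lambda>q r. r \<le> q) A)"
      by (rule partial_order_on_relation_ofI) auto
    fix C assume "C \<in> Chains (relation_of (\<lambda>q r. r \<le> q) A)"
    then have C: "C \<subseteq> A" "\<And>q r. q \<in> C \<Longrightarrow> r \<in> C \<Longrightarrow> q \<le> r \<or> r \<le> q"
      by (auto simp: Chains_def relation_of_def)
    show "\<exists>u\<in>A. \<forall>q\<in>C. u \<le> q"
    proof (cases "C = {}")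
      case True
      then show ?thesis using assms by (auto simp: A_def)
    next
      case False
      then obtain q where "q \<in> C" by blast
      have mem: "\<And>q. q \<in> C \<Longrightarrow> sublinear q \<and> q \<le> p"
        using C(1) by (auto simp: A_def)
      show ?thesis
        using sublinear_chain_Inf[OF False mem C(2)] mem[OF \<open>q \<in> C\<close>] \<open>q \<in> C\<close>
        by (intro bexI[of _ "\<lambda>x. INF q\<in>C. q x"]) (auto simp: A_def intro: order_trans)
    qed
  qed
  then obtain m where m: "sublinear m" "m \<le> p"
    and min: "\<And>q. sublinear q \<Longrightarrow> q \<le> m \<Longrightarrow> q = m"
    unfolding A_def by (auto intro: order_trans)
  \<comment> \<open>tilting cannot lower the minimal \<open>m\<close>, which makes \<open>m\<close> superadditive\<close>
  have add: "m (x + y) = m x + m y" for x y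
  proof -
    define q where "q = (\<lambda>x. INF t\<in>{0..}. m (x + t *\<^sub>R y) - t * m y)"
    have q: "sublinear q" "\<And>t x. 0 \<le> t \<Longrightarrow> q x \<le> m (x + t *\<^sub>R y) - t * m y"
      unfolding q_def by (rule sublinear_tilt[OF m(1)], rule sublinear_tilt[OF m(1)])
    have "q \<le> m"
      using q(2)[of 0] by (auto simp: le_fun_def)
    with q(1) have "q = m" by (rule min)
    then have "m x \<le> m (x + y) - m y"
      using q(2)[of 1 x] by simp
    moreover have "m (x + y) \<le> m x + m y"
      using m(1) by (simp add: sublinear_def)
    ultimately show ?thesis by simp
  qed
  have neg: "m (- x) = - m x" for x
    using add[of x "- x"] sublinear_zero[OF m(1)] by simp
  have "linear m"
  proof (rule linearI)
    show "m (c *\<^sub>R x) = c *\<^sub>R m x" for c x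
    proof (cases "0 \<le> c")
      case False
      then have "m ((- c) *\<^sub>R x) = - c * m x"
        by (intro sublinear_scaleR m(1)) simp
      then show ?thesis using neg[of "c *\<^sub>R x"] by simp
    qed (simp add: sublinear_scaleR m(1))
  qed (rule add)
  then show thesis
    using m(2) by (intro that) (auto simp: le_fun_def)
qed

text \<open>A linear functional below the tilt of \<open>p\<close> along \<open>y\<close> stays
  below \<open>p\<close> and is at most \<open>- p y\<close> at \<open>- y\<close>, so it touches
  \<open>p\<close> at \<open>y\<close>.\<close>

theorem Hahn_Banach_sublinear:
  fixes p :: "'a::real_vector \<Rightarrow> real"
  assumes "sublinear p"
  obtains f where "linear f" "\<And>x. f x \<le> p x" "f y = p y"
proof -
  note q = sublinear_tilt[OF assms, where y = y]
  obtain f where f: "linear f" "\<And>x. f x \<le> (INF t\<in>{0..}. p (x + t *\<^sub>R y) - t * p y)"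
    using sublinear_dominates_linear[OF q(1)] by blast
  have le: "f x \<le> p (x + t *\<^sub>R y) - t * p y" if "0 \<le> t" for x t
    using f(2) q(2)[OF that] by (rule order_trans)
  have "f x \<le> p x" for x
    using le[of 0 x] by simp
  moreover have "p y \<le> f y"
    using le[of 1 "- y"] sublinear_zero[OF assms] linear_neg[OF f(1)] by simp
  ultimately show thesis
    using that f(1) by (meson antisym)
qed

section \<open>Positive norming functionals and uniform boundedness\<close>

text \<open>Hahn-Banach is applied to the norm of the positive part. It vanishes on negative
  elements, which forces positivity, and is at most the norm, which gives the bound
  \<open>1\<close>.\<close>

lemma positive_norming_functional:
  fixes w :: "'a::banach_lattice"
  assumes "0 \<le> w"
  obtains f :: "'a \<Rightarrow>\<^sub>L real" where "0 \<le> f" "norm f \<le> 1" "f w = norm w"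
proof -
  have "sublinear (\<lambda>x::'a. norm (sup x 0))"
    unfolding sublinear_def
  proof (intro conjI allI impI)
    fix x y :: 'a
    have "norm (sup (x + y) 0) \<le> norm (sup x 0 + sup y 0)"
      by (intro norm_mono sup_least add_mono) (auto intro: add_nonneg_nonneg)
    also have "\<dots> \<le> norm (sup x 0) + norm (sup y 0)" by (rule norm_triangle_ineq)
    finally show "norm (sup (x + y) 0) \<le> norm (sup x 0) + norm (sup y 0)" .
  next
    fix c :: real and x :: 'a assume "0 \<le> c"
    then have "sup (c *\<^sub>R x) 0 = c *\<^sub>R sup x 0" by (simp add: scaleR_sup)
    with \<open>0 \<le> c\<close> show "norm (sup (c *\<^sub>R x) 0) \<le> c * norm (sup x 0)" by simp
  qed
  then obtain f where f: "linear f" "\<And>x::'a. f x \<le> norm (sup x 0)" "f w = norm (sup w 0)"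
    using Hahn_Banach_sublinear by blast
  have le: "f x \<le> norm x" for x
    using f(2)[of x] norm_sup_zero_le[of x] by simp
  have bound: "norm (f x) \<le> norm x * 1" for x
    using le[of x] le[of "- x"] linear_neg[OF f(1)] by (simp add: abs_le_iff)
  then have "bounded_linear f"
    using f(1) by (intro bounded_linear_intro[where K = 1]) (auto simp: linear_add linear_scale)
  then have app: "blinfun_apply (Blinfun f) = f"
    by (rule bounded_linear_Blinfun_apply)
  have "0 \<le> f x" if "0 \<le> x" for x
    using f(2)[of "- x"] that linear_neg[OF f(1)] by (simp add: sup_absorb2)
  moreover have "f w = norm w"
    using f(3) assms by (simp add: sup_absorb1)
  moreover have "norm (Blinfun f) \<le> 1"
    using bound by (intro norm_blinfun_bound) (auto simp: app)
  ultimately show thesis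
    by (intro that[of "Blinfun f"]) (auto simp: app less_eq_blinfun_def)
qed

text \<open>Uniform boundedness by Baire category: if every open set \<open>U k\<close> were dense,
  some point would lie in all of them, contradicting pointwise boundedness. Hence some
  \<open>U k\<close> misses a ball, on which \<open>k\<close> bounds all \<open>f n\<close>.\<close>

lemma weak_star_null_norm_bounded:
  fixes f :: "nat \<Rightarrow> 'a::banach \<Rightarrow>\<^sub>L real"
  assumes "weak_star_null f"
  obtains K where "\<And>n. norm (f n) \<le> K"
proof -
  define U where "U k = {x. \<exists>n. real k < \<bar>f n x\<bar>}" for k
  have open_U: "open (U k)" for k
  proof -
    have "U k = (\<Union>n. {x. real k < \<bar>f n x\<bar>})" by (auto simp: U_def)
    then show ?thesis
      by (auto intro!: open_UN open_Collect_less continuous_intros)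
  qed
  have bounded: "\<exists>K. \<forall>n. \<bar>f n x\<bar> \<le> K" for x
    using assms convergent_imp_Bseq[of "\<lambda>n. f n x"]
    unfolding weak_star_null_def convergent_def Bseq_def by fastforce
  have "\<exists>k. closure (U k) \<noteq> UNIV"
  proof (rule ccontr)
    assume dense: "\<nexists>k. closure (U k) \<noteq> UNIV"
    have "euclidean closure_of \<Inter>(range U) = topspace (euclidean :: 'a topology)"
    proof (rule Baire_category)
      show "completely_metrizable_space (euclidean :: 'a topology) \<or>
          locally_compact_space (euclidean :: 'a topology) \<and> regular_space (euclidean :: 'a topology)"
        using completely_metrizable_space_euclidean by blast
    qed (use open_U dense in auto)
    then have "\<Inter>(range U) \<noteq> {}" by auto
    then obtain x where x: "\<And>k. x \<in> U k" by blast
    obtain K where "\<And>n. \<bar>f n x\<bar> \<le> K" using bounded by blast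
    moreover obtain k :: nat where "K < k" using reals_Archimedean2 by blast
    ultimately show False
      using x[of k] unfolding U_def by (smt (verit) mem_Collect_eq)
  qed
  then obtain k a where "a \<notin> closure (U k)" by blast
  then obtain r where r: "0 < r" "\<And>x. x \<in> U k \<Longrightarrow> r \<le> dist x a"
    unfolding closure_approachable by (meson linorder_not_less)
  have fk: "\<bar>f n x\<bar> \<le> k" if "dist x a < r" for n x
    using r(2)[of x] that unfolding U_def by (metis linorder_not_less mem_Collect_eq)
  have "norm (f n) \<le> 4 * real k / r" for n
  proof (rule norm_blinfun_bound)
    show "0 \<le> 4 * real k / r" using r(1) by simp
    fix x
    show "norm (f n x) \<le> 4 * real k / r * norm x"
    proof (cases "x = 0")
      case False
      \<comment> \<open>\<open>c\<close> scales \<open>x\<close> to norm \<open>r / 2\<close>, so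
        that \<open>a + c x\<close> lies in the ball. Subtracting the value at \<open>a\<close>
        gives the bound \<open>2 k\<close> at \<open>c x\<close>, hence the constant
        \<open>4 k / r\<close>.\<close>
      define c where "c = r / (2 * norm x)"
      have c: "0 < c" using r(1) False by (simp add: c_def)
      have "norm (c *\<^sub>R x) < r" using r(1) False by (simp add: c_def)
      then have "\<bar>f n (a + c *\<^sub>R x)\<bar> \<le> k" "\<bar>f n a\<bar> \<le> k"
        using r(1) by (auto intro!: fk simp: dist_norm)
      then have "\<bar>c * f n x\<bar> \<le> 2 * k"
        unfolding blinfun.add_right blinfun.scaleR_right real_scaleR_def by linarith
      then have "c * \<bar>f n x\<bar> \<le> 2 * k"
        using c by (simp add: abs_mult)
      then show ?thesis
        using r(1) False by (simp add: c_def field_simps)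
    qed simp
  qed
  then show thesis by (rule that)
qed

subsection \<open>Components of positive functionals\<close>

lemma positive_blinfun_mono:
  fixes f :: "'a::banach_lattice \<Rightarrow>\<^sub>L real"
  assumes "0 \<le> f" "x \<le> y"
  shows "f x \<le> f y"
  using assms(1)[unfolded less_eq_blinfun_def, rule_format, of "y - x"] assms(2)
  by (simp add: blinfun.diff_right)

lemma positive_blinfun_nonneg:
  fixes f :: "'a::banach_lattice \<Rightarrow>\<^sub>L real"
  assumes "0 \<le> f" "0 \<le> x"
  shows "0 \<le> f x"
  using positive_blinfun_mono[OF assms] by simp

text \<open>The extension is the difference of \<open>s\<close> at the positive and the negative
  part. It can be computed from any decomposition \<open>x = a - b\<close> into positive elements,
  because \<open>sup x 0 + b = a + sup (- x) 0\<close>; linearity follows by choosing convenient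
  decompositions.\<close>

lemma extend_from_positive_cone:
  fixes s :: "'a::banach_lattice \<Rightarrow> real"
  assumes add: "\<And>x y. 0 \<le> x \<Longrightarrow> 0 \<le> y \<Longrightarrow> s (x + y) = s x + s y"
    and scale: "\<And>c x. 0 \<le> c \<Longrightarrow> 0 \<le> x \<Longrightarrow> s (c *\<^sub>R x) = c * s x"
    and bound: "\<And>x. 0 \<le> x \<Longrightarrow> \<bar>s x\<bar> \<le> K * norm x"
  obtains f :: "'a \<Rightarrow>\<^sub>L real" where "\<And>x. 0 \<le> x \<Longrightarrow> f x = s x"
proof -
  define t where "t x = s (sup x 0) - s (sup (- x) 0)" for x
  have split: "sup x 0 - sup (- x) 0 = x" for x :: 'a
    using prts[of x] unfolding pprt_def nprt_def inf_eq_neg_sup[of x 0] minus_zero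
    by (simp only: diff_conv_add_uminus)
  have t: "t (a - b) = s a - s b" if "0 \<le> a" "0 \<le> b" for a b
  proof -
    define x where "x = a - b"
    have "sup x 0 - sup (- x) 0 = a - b"
      unfolding split by (rule x_def)
    then have eq: "sup x 0 + b = a + sup (- x) 0"
      by (metis add_diff_cancel_right' add.commute add.assoc diff_add_cancel)
    have "s (sup x 0) + s b = s (sup x 0 + b)"
      by (rule add[symmetric]) (auto intro: that)
    also have "\<dots> = s a + s (sup (- x) 0)"
      unfolding eq by (rule add) (auto intro: that)
    finally show ?thesis unfolding t_def x_def[symmetric] by linarith
  qed
  have "bounded_linear t"
  proof (rule bounded_linear_intro[where K = "2 * \<bar>K\<bar>"])
    fix x y :: 'a
    have "x + y = (sup x 0 + sup y 0) - (sup (- x) 0 + sup (- y) 0)"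
      by (subst (1) split[of x, symmetric], subst (1) split[of y, symmetric]) (simp only: add_diff_add)
    then have "t (x + y) = s (sup x 0 + sup y 0) - s (sup (- x) 0 + sup (- y) 0)"
      by (simp add: t add_nonneg_nonneg)
    then show "t (x + y) = t x + t y"
      by (simp add: add t_def)
  next
    fix c and x :: 'a
    show "t (c *\<^sub>R x) = c *\<^sub>R t x"
    proof (cases "0 \<le> c")
      case True
      have "c *\<^sub>R x = c *\<^sub>R sup x 0 - c *\<^sub>R sup (- x) 0"
        using split[of x] by (metis scaleR_diff_right)
      then have "t (c *\<^sub>R x) = s (c *\<^sub>R sup x 0) - s (c *\<^sub>R sup (- x) 0)"
        using True by (simp add: t scaleR_nonneg_nonneg)
      then show ?thesis
        using True by (simp add: scale t_def right_diff_distrib)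
    next
      case False
      \<comment> \<open>A negative factor exchanges the positive and the negative part.\<close>
      have "c *\<^sub>R x = (- c) *\<^sub>R sup (- x) 0 - (- c) *\<^sub>R sup x 0"
        using split[of x] by (metis scaleR_diff_right scaleR_minus_left minus_diff_eq)
      then have "t (c *\<^sub>R x) = s ((- c) *\<^sub>R sup (- x) 0) - s ((- c) *\<^sub>R sup x 0)"
        using False by (metis t scaleR_nonneg_nonneg sup_ge2 neg_0_le_iff_le nle_le)
      also have "\<dots> = (- c) * s (sup (- x) 0) - (- c) * s (sup x 0)"
        using False by (subst (1 2) scale) auto
      finally show ?thesis
        by (simp add: t_def algebra_simps)
    qed
  next
    fix x :: 'a
    have *: "\<bar>s (sup y 0)\<bar> \<le> \<bar>K\<bar> * norm y" for y :: 'a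
    proof -
      have "\<bar>s (sup y 0)\<bar> \<le> K * norm (sup y 0)" by (rule bound) simp
      also have "\<dots> \<le> \<bar>K\<bar> * norm y"
        using norm_sup_zero_le[of y] by (intro mult_mono) auto
      finally show ?thesis .
    qed
    show "norm (t x) \<le> norm x * (2 * \<bar>K\<bar>)"
      using *[of x] *[of "- x"] unfolding t_def real_norm_def norm_minus_cancel
      by (simp add: algebra_simps abs_le_iff)
  qed
  then have "blinfun_apply (Blinfun t) = t"
    by (rule bounded_linear_Blinfun_apply)
  moreover have "s 0 = 0"
    using scale[of 0 0] by simp
  ultimately show thesis
    using t[of _ 0] by (intro that[of "Blinfun t"]) simp
qed

lemma positive_blinfun_bdd_above:
  fixes \<phi> :: "'a::banach_lattice \<Rightarrow>\<^sub>L real"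
  assumes "0 \<le> \<phi>"
  shows "bdd_above ((\<lambda>g. \<phi> (inf x g)) ` G)"
  by (rule bdd_aboveI2[where M = "\<phi> x"]) (simp add: positive_blinfun_mono[OF assms])

text \<open>The component of \<open>\<phi>\<close> carried by the ideal whose positive cone is \<open>G\<close>.\<close>

lemma functional_component:
  fixes \<phi> :: "'a::banach_lattice \<Rightarrow>\<^sub>L real"
  assumes "0 \<le> \<phi>" "G \<noteq> {}" "\<And>g. g \<in> G \<Longrightarrow> 0 \<le> g"
    and add: "\<And>g h. g \<in> G \<Longrightarrow> h \<in> G \<Longrightarrow> g + h \<in> G"
    and scale: "\<And>c g. 0 < c \<Longrightarrow> g \<in> G \<Longrightarrow> c *\<^sub>R g \<in> G"
  obtains \<psi> :: "'a \<Rightarrow>\<^sub>L real" where "\<And>x. 0 \<le> x \<Longrightarrow> \<psi> x = (SUP g\<in>G. \<phi> (inf x g))"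
proof -
  define s where "s x = (SUP g\<in>G. \<phi> (inf x g))" for x
  have upper: "\<phi> (inf x g) \<le> s x" if "g \<in> G" for x g
    unfolding s_def using that by (intro cSUP_upper positive_blinfun_bdd_above[OF assms(1)])
  have least: "s x \<le> c" if "\<And>g. g \<in> G \<Longrightarrow> \<phi> (inf x g) \<le> c" for x c
    unfolding s_def using that assms(2) by (intro cSUP_least)
  have mono: "\<phi> x \<le> \<phi> y" if "x \<le> y" for x y
    using positive_blinfun_mono[OF assms(1) that] .
  have s_add: "s (x + y) = s x + s y" if "0 \<le> x" "0 \<le> y" for x y
  proof (rule antisym)
    show "s (x + y) \<le> s x + s y"
    proof (rule least)
      fix g assume g: "g \<in> G"
      have "\<phi> (inf (x + y) g) \<le> \<phi> (inf x g + inf y g)"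
        using that assms(3)[OF g] by (intro mono inf_add_le)
      also have "\<dots> \<le> s x + s y"
        using upper[OF g, of x] upper[OF g, of y] by (simp add: blinfun.add_right)
      finally show "\<phi> (inf (x + y) g) \<le> s x + s y" .
    qed
    \<comment> \<open>Superadditivity: for separate \<open>g\<close> and \<open>h\<close>, the
      element \<open>g + h\<close> of \<open>G\<close> serves both. The supremum is taken over
      \<open>g\<close> first and over \<open>h\<close> afterwards.\<close>
    have "s x \<le> s (x + y) - \<phi> (inf y h)" if h: "h \<in> G" for h
    proof (rule least)
      fix g assume g: "g \<in> G"
      have "\<phi> (inf x g + inf y h) \<le> \<phi> (inf (x + y) (g + h))"
        by (intro mono inf_greatest add_mono) auto
      also have "\<dots> \<le> s (x + y)"
        using g h by (intro upper add)
      finally show "\<phi> (inf x g) \<le> s (x + y) - \<phi> (inf y h)"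
        by (simp add: blinfun.add_right)
    qed
    then have "s y \<le> s (x + y) - s x"
      by (intro least) (simp add: algebra_simps)
    then show "s x + s y \<le> s (x + y)" by simp
  qed
  \<comment> \<open>\<open>G\<close> is invariant under positive scaling, so \<open>g\<close> may be
    replaced by \<open>inverse c *\<^sub>R g\<close>. The reverse inequality will come from the
    factor \<open>inverse c\<close>.\<close>
  have s_scale_le: "s (c *\<^sub>R x) \<le> c * s x" if "0 < c" for c x
  proof (rule least)
    fix g assume "g \<in> G"
    then have "inverse c *\<^sub>R g \<in> G" using that by (intro scale) auto
    then have "c * \<phi> (inf x (inverse c *\<^sub>R g)) \<le> c * s x"
      using that by (intro mult_left_mono upper) auto
    moreover have "c *\<^sub>R inf x (inverse c *\<^sub>R g) = inf (c *\<^sub>R x) g"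
      using that by (simp add: scaleR_inf)
    ultimately show "\<phi> (inf (c *\<^sub>R x) g) \<le> c * s x"
      by (metis blinfun.scaleR_right real_scaleR_def)
  qed
  have s_nonneg: "0 \<le> s x" if "0 \<le> x" for x
  proof -
    obtain g where "g \<in> G" using assms(2) by blast
    then show ?thesis
      using positive_blinfun_nonneg[OF assms(1), of "inf x g"] upper[of g x] assms(3)[of g] that
      by simp
  qed
  have s_le: "s x \<le> \<phi> x" for x
    by (intro least mono) simp
  obtain \<psi> :: "'a \<Rightarrow>\<^sub>L real" where "\<And>x. 0 \<le> x \<Longrightarrow> \<psi> x = s x"
  proof (rule extend_from_positive_cone)
    show "s (c *\<^sub>R x) = c * s x" if "0 \<le> c" "0 \<le> x" for c x
    proof (cases "c = 0")
      case True
      then show ?thesis using s_nonneg[of 0] s_le[of 0] by simp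
    next
      case False
      with that have "0 < c" by simp
      then have "s (inverse c *\<^sub>R c *\<^sub>R x) \<le> inverse c * s (c *\<^sub>R x)"
        by (intro s_scale_le) simp
      with \<open>0 < c\<close> have "c * s x \<le> s (c *\<^sub>R x)"
        by (simp add: field_simps)
      with s_scale_le[OF \<open>0 < c\<close>] show ?thesis by (intro antisym)
    qed
    show "\<bar>s x\<bar> \<le> norm \<phi> * norm x" if "0 \<le> x" for x
      using s_nonneg[OF that] s_le[of x] norm_blinfun[of \<phi> x] by simp
  qed (use s_add in auto)
  then show thesis
    by (intro that) (simp add: s_def)
qed

text \<open>Let \<open>\<Phi>N N\<close> and \<open>\<Phi>\<close> be the components of
  \<open>\<phi>\<close> on the ideals generated by the first \<open>N\<close> terms and by all
  terms. The differences \<open>\<Phi> - \<Phi>N N\<close> decrease to \<open>0\<close>, so their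
  norms tend to \<open>0\<close>. At \<open>x n\<close>, \<open>\<Phi>\<close> is at least
  \<open>\<phi>\<close> and \<open>\<Phi>N n\<close> is at most \<open>0\<close>, so
  \<open>\<phi> (x n)\<close> is bounded by \<open>norm (\<Phi> - \<Phi>N n) * K\<close>.\<close>

theorem disjoint_seq_positive_functional_tendsto_zero:
  fixes \<phi> :: "'a::banach_lattice \<Rightarrow>\<^sub>L real"
  assumes oc: "order_continuous_norm TYPE('a \<Rightarrow>\<^sub>L real)"
    and "0 \<le> \<phi>" "disjoint_seq x" "\<And>n. 0 \<le> x n" "\<And>n. norm (x n) \<le> K"
  shows "(\<lambda>n. \<phi> (x n)) \<longlonglongrightarrow> 0"
proof -
  \<comment> \<open>The positive cone of the ideal generated by the \<open>x i\<close> with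
    \<open>i < N\<close>. Because of the strict bound, \<open>x n\<close> belongs to
    \<open>G (Suc n)\<close> and is disjoint from \<open>G n\<close>.\<close>
  define G where "G N = {g. 0 \<le> g \<and> (\<exists>c\<ge>0. g \<le> c *\<^sub>R (\<Sum>i<N. x i))}" for N :: nat
  have G_mono: "G M \<subseteq> G N" if "M \<le> N" for M N
  proof
    fix g assume "g \<in> G M"
    then obtain c where c: "0 \<le> g" "0 \<le> c" "g \<le> c *\<^sub>R (\<Sum>i<M. x i)"
      by (auto simp: G_def)
    note c(3)
    also have "c *\<^sub>R (\<Sum>i<M. x i) \<le> c *\<^sub>R (\<Sum>i<N. x i)"
      using that assms(4) c(2) by (intro scaleR_left_mono sum_mono2) auto
    finally show "g \<in> G N" using c by (auto simp: G_def)
  qed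
  have G_zero: "0 \<in> G N" for N
    by (auto simp: G_def)
  have G_nonneg: "0 \<le> g" if "g \<in> G N" for g N
    using that by (simp add: G_def)
  have G_add: "g + h \<in> G N" if "g \<in> G N" "h \<in> G N" for g h N
  proof -
    obtain c d where "0 \<le> g" "0 \<le> c" "g \<le> c *\<^sub>R (\<Sum>i<N. x i)" "0 \<le> h" "0 \<le> d" "h \<le> d *\<^sub>R (\<Sum>i<N. x i)"
      using \<open>g \<in> G N\<close> \<open>h \<in> G N\<close> by (auto simp: G_def)
    then have "0 \<le> g + h" "0 \<le> c + d" "g + h \<le> (c + d) *\<^sub>R (\<Sum>i<N. x i)"
      by (auto simp: scaleR_add_left intro: add_mono)
    then show ?thesis by (auto simp: G_def)
  qed
  have G_scale: "a *\<^sub>R g \<in> G N" if "0 < a" "g \<in> G N" for a g N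
  proof -
    obtain c where "0 \<le> g" "0 \<le> c" "g \<le> c *\<^sub>R (\<Sum>i<N. x i)"
      using \<open>g \<in> G N\<close> by (auto simp: G_def)
    then have "0 \<le> a *\<^sub>R g" "0 \<le> a * c" "a *\<^sub>R g \<le> (a * c) *\<^sub>R (\<Sum>i<N. x i)"
      using that scaleR_left_mono[of g "c *\<^sub>R (\<Sum>i<N. x i)" a] by (auto intro: scaleR_nonneg_nonneg)
    then show ?thesis by (auto simp: G_def)
  qed
  have "\<exists>\<psi> :: 'a \<Rightarrow>\<^sub>L real. \<forall>z\<ge>0. \<psi> z = (SUP g\<in>G N. \<phi> (inf z g))" for N
    by (rule functional_component[OF \<open>0 \<le> \<phi>\<close>, of "G N"])
      (use G_zero G_nonneg G_add G_scale in blast)+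
  then obtain \<Phi>N :: "nat \<Rightarrow> 'a \<Rightarrow>\<^sub>L real"
    where \<Phi>N: "\<And>N z. 0 \<le> z \<Longrightarrow> \<Phi>N N z = (SUP g\<in>G N. \<phi> (inf z g))"
    by metis
  have G_Un_add: "g + h \<in> (\<Union>N. G N)" if "g \<in> (\<Union>N. G N)" "h \<in> (\<Union>N. G N)" for g h
  proof -
    from that obtain M N where "g \<in> G M" "h \<in> G N" by auto
    then have "g + h \<in> G (max M N)"
      using G_mono[of M "max M N"] G_mono[of N "max M N"] by (intro G_add) auto
    then show ?thesis by blast
  qed
  have "\<exists>\<psi> :: 'a \<Rightarrow>\<^sub>L real. \<forall>z\<ge>0. \<psi> z = (SUP g\<in>(\<Union>N. G N). \<phi> (inf z g))"
  proof (rule functional_component[OF \<open>0 \<le> \<phi>\<close> _ _ G_Un_add])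
    show "(\<Union>N. G N) \<noteq> {}" using G_zero by blast
    show "0 \<le> g" if "g \<in> (\<Union>N. G N)" for g using that G_nonneg by blast
    show "c *\<^sub>R g \<in> (\<Union>N. G N)" if "0 < c" "g \<in> (\<Union>N. G N)" for c g
      using that G_scale by blast
  qed auto
  then obtain \<Phi> :: "'a \<Rightarrow>\<^sub>L real"
    where \<Phi>: "\<And>z. 0 \<le> z \<Longrightarrow> \<Phi> z = (SUP g\<in>(\<Union>N. G N). \<phi> (inf z g))"
    by blast
  have upN: "\<phi> (inf z g) \<le> \<Phi>N N z" if "0 \<le> z" "g \<in> G N" for z g N
    unfolding \<Phi>N[OF that(1)] using that by (intro cSUP_upper positive_blinfun_bdd_above[OF \<open>0 \<le> \<phi>\<close>])
  have up: "\<phi> (inf z g) \<le> \<Phi> z" if "0 \<le> z" "g \<in> G N" for z g N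
    unfolding \<Phi>[OF that(1)] using that by (intro cSUP_upper positive_blinfun_bdd_above[OF \<open>0 \<le> \<phi>\<close>]) auto
  have leastN: "\<Phi>N N z \<le> c" if "0 \<le> z" "\<And>g. g \<in> G N \<Longrightarrow> \<phi> (inf z g) \<le> c" for z c N
    unfolding \<Phi>N[OF that(1)] using that(2) G_zero[of N] by (intro cSUP_least) auto
  have least: "\<Phi> z \<le> c" if "0 \<le> z" "\<And>g N. g \<in> G N \<Longrightarrow> \<phi> (inf z g) \<le> c" for z c
    unfolding \<Phi>[OF that(1)] using that(2) G_zero by (intro cSUP_least) fastforce+
  have \<Phi>N_mono: "\<Phi>N M \<le> \<Phi>N N" if "M \<le> N" for M N
    unfolding less_eq_blinfun_def using G_mono[OF that] by (auto intro!: leastN upN)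
  have \<Phi>N_le: "\<Phi>N N \<le> \<Phi>" for N
    unfolding less_eq_blinfun_def by (auto intro!: leastN up)
  have "decreases_to_zero (range (\<lambda>N. \<Phi> - \<Phi>N N))"
    unfolding decreases_to_zero_def
  proof (intro conjI ballI allI impI)
    fix a b assume "a \<in> range (\<lambda>N. \<Phi> - \<Phi>N N)" "b \<in> range (\<lambda>N. \<Phi> - \<Phi>N N)"
    then obtain M N where "a = \<Phi> - \<Phi>N M" "b = \<Phi> - \<Phi>N N" by auto
    then show "\<exists>c\<in>range (\<lambda>N. \<Phi> - \<Phi>N N). c \<le> a \<and> c \<le> b"
      using \<Phi>N_mono[of M "max M N"] \<Phi>N_mono[of N "max M N"]
      by (intro bexI[of _ "\<Phi> - \<Phi>N (max M N)"]) auto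
  next
    \<comment> \<open>A lower bound \<open>l\<close> of all differences makes
      \<open>\<Phi> z - l z\<close> an upper bound of every \<open>\<phi> (inf z g)\<close>, and
      \<open>\<Phi> z\<close> is the least one.\<close>
    fix l assume l: "\<forall>a\<in>range (\<lambda>N. \<Phi> - \<Phi>N N). l \<le> a"
    have "l z \<le> 0" if "0 \<le> z" for z
    proof -
      have "\<Phi> z \<le> \<Phi> z - l z"
      proof (rule least[OF that])
        fix g N assume g: "g \<in> G N"
        have "l \<le> \<Phi> - \<Phi>N N" using l by blast
        then have "l z \<le> \<Phi> z - \<Phi>N N z"
          using that by (simp add: less_eq_blinfun_def blinfun.diff_left)
        then show "\<phi> (inf z g) \<le> \<Phi> z - l z"
          using upN[OF that g] by simp
      qed
      then show ?thesis by simp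
    qed
    then show "l \<le> 0" by (simp add: less_eq_blinfun_def)
  qed (use \<Phi>N_le in auto)
  then have small: "\<exists>d\<in>range (\<lambda>N. \<Phi> - \<Phi>N N). \<forall>d'\<in>range (\<lambda>N. \<Phi> - \<Phi>N N). d' \<le> d \<longrightarrow> norm d' < e"
    if "0 < e" for e
    using oc that unfolding order_continuous_norm_def by blast
  have le: "\<phi> (x n) \<le> norm (\<Phi> - \<Phi>N n) * K" for n
  proof -
    have "1 *\<^sub>R x n \<le> 1 *\<^sub>R (\<Sum>i<Suc n. x i)"
      using assms(4) by (simp add: add_increasing sum_nonneg)
    then have "x n \<in> G (Suc n)"
      using assms(4) unfolding G_def by (auto intro: exI[of _ "1::real"])
    then have "\<phi> (x n) \<le> \<Phi> (x n)"
      using up[OF assms(4)] by (metis inf.idem)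
    moreover have "\<Phi>N n (x n) \<le> 0"
    proof (rule leastN[OF assms(4)])
      fix g assume "g \<in> G n"
      then obtain c where c: "0 \<le> g" "0 \<le> c" "g \<le> c *\<^sub>R (\<Sum>i<n. x i)" by (auto simp: G_def)
      have "inf (x n) (\<Sum>i<n. x i) = 0"
        using assms(3,4) unfolding disjoint_seq_def
        by (intro disjoint_sum) (auto simp: abs_of_nonneg)
      then have "inf (1 *\<^sub>R x n) (c *\<^sub>R (\<Sum>i<n. x i)) = 0"
        using c assms(4) by (intro disjoint_scaleR) (auto intro: sum_nonneg)
      then have "inf (x n) g = 0"
        using c assms(4) by (intro disjoint_mono[of "x n" "x n" g]) auto
      then show "\<phi> (inf (x n) g) \<le> 0" by simp
    qed
    ultimately have "\<phi> (x n) \<le> (\<Phi> - \<Phi>N n) (x n)"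
      by (simp add: blinfun.diff_left)
    also have "\<dots> \<le> norm (\<Phi> - \<Phi>N n) * norm (x n)"
      using norm_blinfun[of "\<Phi> - \<Phi>N n" "x n"] by simp
    also have "\<dots> \<le> norm (\<Phi> - \<Phi>N n) * K"
      by (intro mult_left_mono assms) auto
    finally show ?thesis .
  qed
  have "(\<lambda>n. norm (\<Phi> - \<Phi>N n)) \<longlonglongrightarrow> 0"
  proof (rule LIMSEQ_I)
    fix r :: real assume "0 < r"
    then obtain N where N: "\<And>n. \<Phi> - \<Phi>N n \<le> \<Phi> - \<Phi>N N \<Longrightarrow> norm (\<Phi> - \<Phi>N n) < r"
      using small[of r] by auto
    have "norm (\<Phi> - \<Phi>N n) < r" if "n \<ge> N" for n
      using \<Phi>N_mono[OF that] by (intro N) simp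
    then show "\<exists>N. \<forall>n\<ge>N. norm (norm (\<Phi> - \<Phi>N n) - 0) < r" by auto
  qed
  then have "(\<lambda>n. norm (\<Phi> - \<Phi>N n) * K) \<longlonglongrightarrow> 0"
    by (rule tendsto_mult_left_zero)
  then show ?thesis
    by (rule tendsto_sandwich[OF _ _ tendsto_const, rotated 2])
      (use le positive_blinfun_nonneg[OF \<open>0 \<le> \<phi>\<close> assms(4)] in auto)
qed

subsection \<open>Disjointification and L-weakly compact operators\<close>

text \<open>Disjointification: if all these sets were finite, one could choose \<open>r\<close> so
  that the part of \<open>y (r (Suc k))\<close> above \<open>4 ^ k\<close> times the sum of the
  terms up to \<open>r k\<close> has norm more than \<open>\<delta>\<close>. Cutting off a further
  \<open>(1/2) ^ k *\<^sub>R Y\<close> makes these parts disjoint at a vanishing cost in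
  norm.\<close>

lemma infinite_almost_dominated:
  fixes y :: "nat \<Rightarrow> 'a::banach_lattice"
  assumes "\<And>n. 0 \<le> y n" "\<And>n. norm (y n) \<le> K" "0 < \<delta>"
    and disj: "\<And>z. disjoint_seq z \<Longrightarrow> (\<And>k. \<exists>n. 0 \<le> z k \<and> z k \<le> y n) \<Longrightarrow> z \<longlonglongrightarrow> 0"
  obtains c N where "0 \<le> c" "infinite {n. norm (sup (y n - c *\<^sub>R (\<Sum>i\<le>N. y i)) 0) \<le> \<delta>}"
proof (rule ccontr)
  assume "\<not> thesis"
  with that have fin: "finite {n. norm (sup (y n - c *\<^sub>R (\<Sum>i\<le>N. y i)) 0) \<le> \<delta>}"
    if "0 \<le> c" for c N
    using \<open>0 \<le> c\<close> by blast
  have next_ex: "\<exists>n>N. \<delta> < norm (sup (y n - c *\<^sub>R (\<Sum>i\<le>N. y i)) 0)" if c: "0 \<le> c" for c N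
  proof -
    obtain M where M: "\<And>n. norm (sup (y n - c *\<^sub>R (\<Sum>i\<le>N. y i)) 0) \<le> \<delta> \<Longrightarrow> n < M"
      using fin[OF c, of N] unfolding finite_nat_set_iff_bounded by auto
    show ?thesis
      using M[of "max M (Suc N)"] by (intro exI[of _ "max M (Suc N)"]) force
  qed
  have "\<exists>r. \<forall>k. True \<and> (r k < r (Suc k) \<and>
      \<delta> < norm (sup (y (r (Suc k)) - 4 ^ k *\<^sub>R (\<Sum>i\<le>r k. y i)) 0))"
    using next_ex[of "4 ^ _"] by (intro dependent_nat_choice) auto
  then obtain r :: "nat \<Rightarrow> nat" where r: "\<And>k. r k < r (Suc k)"
    "\<And>k. \<delta> < norm (sup (y (r (Suc k)) - 4 ^ k *\<^sub>R (\<Sum>i\<le>r k. y i)) 0)"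
    by auto
  have r_mono: "r i \<le> r j" if "i \<le> j" for i j
    using r(1) that by (simp add: lift_Suc_mono_le less_imp_le)
  \<comment> \<open>The weights make the series converge absolutely, so that a single
    \<open>Y\<close> dominates every \<open>(1/2) ^ k *\<^sub>R y (r k)\<close>.\<close>
  define a where "a k = (1/2) ^ k *\<^sub>R y (r k)" for k
  define Y where "Y = suminf a"
  have a_nonneg: "0 \<le> a k" for k
    by (simp add: a_def assms(1) scaleR_nonneg_nonneg)
  have "summable a"
  proof (rule summable_comparison_test')
    show "summable (\<lambda>k. K * (1/2) ^ k)"
      by (intro summable_mult summable_geometric) simp
    show "norm (a k) \<le> K * (1/2) ^ k" for k
      using mult_right_mono[OF assms(2)[of "r k"], of "(1/2) ^ k"] by (simp add: a_def mult.commute)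
  qed
  then have lim: "(\<lambda>n. \<Sum>k<n. a k) \<longlonglongrightarrow> Y"
    unfolding Y_def by (rule summable_LIMSEQ)
  have a_le: "a k \<le> Y" for k
  proof (rule tendsto_mono_banach_lattice[OF tendsto_const lim])
    have "a k \<le> (\<Sum>i<n. a i)" if "k < n" for n
      using sum_mono2[of "{..<n}" "{k}" a] a_nonneg that by simp
    then show "\<forall>\<^sub>F n in sequentially. a k \<le> (\<Sum>i<n. a i)"
      by (intro eventually_mono[OF eventually_gt_at_top[of k]])
  qed
  have Y_nonneg: "0 \<le> Y"
    using a_nonneg[of 0] a_le[of 0] by (rule order_trans)
  define z where "z k = sup (y (r (Suc k)) - 4 ^ k *\<^sub>R (\<Sum>i\<le>r k. y i) - (1/2) ^ k *\<^sub>R Y) 0" for k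
  have z_nonneg: "0 \<le> z k" for k by (simp add: z_def)
  have "disjoint_seq z"
  proof -
    have less: "inf (z j) (z k) = 0" if "j < k" for j k
    proof -
      \<comment> \<open>The sum cut off from \<open>Q\<close> contains \<open>P\<close>, so
        \<open>z k\<close> is below the positive part of \<open>Q - 4 ^ k *\<^sub>R P\<close>. The
        cut by \<open>Y\<close> puts \<open>z j\<close> below a multiple of the negative part of the
        same element, and these parts are disjoint.\<close>
      define P where "P = y (r (Suc j))"
      define Q where "Q = y (r (Suc k))"
      have "P \<le> (\<Sum>i\<le>r k. y i)"
        using sum_mono2[of "{..r k}" "{r (Suc j)}" y] assms(1) r_mono[of "Suc j" k] that
        by (simp add: P_def)
      then have "4 ^ k *\<^sub>R P \<le> 4 ^ k *\<^sub>R (\<Sum>i\<le>r k. y i) + (1/2) ^ k *\<^sub>R Y"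
        using Y_nonneg
        by (intro add_increasing2 scaleR_left_mono scaleR_nonneg_nonneg) auto
      then have z_k: "z k \<le> 1 *\<^sub>R sup (Q - 4 ^ k *\<^sub>R P) 0"
        unfolding z_def Q_def[symmetric] diff_diff_eq scaleR_one
        by (intro sup_mono diff_left_mono) auto
      \<comment> \<open>Since \<open>j + Suc k \<le> k + k\<close>, the share
        \<open>(1/2) ^ j *\<^sub>R Y\<close> cut from \<open>P\<close> dominates
        \<open>(1/4) ^ k *\<^sub>R Q\<close>.\<close>
      have "(1/4::real) ^ k = (1/2) ^ (k + k)"
        by (simp add: power_add flip: power_mult_distrib)
      also have "\<dots> \<le> (1/2) ^ (j + Suc k)"
        using that by (intro power_decreasing) auto
      finally have "(1/4) ^ k *\<^sub>R Q \<le> (1/2) ^ (j + Suc k) *\<^sub>R Q"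
        by (intro scaleR_right_mono) (auto simp: Q_def assms(1))
      also have "\<dots> = (1/2) ^ j *\<^sub>R a (Suc k)"
        by (simp add: a_def Q_def power_add)
      also have "\<dots> \<le> (1/2) ^ j *\<^sub>R Y"
        by (intro scaleR_left_mono a_le) auto
      also have "\<dots> \<le> 4 ^ j *\<^sub>R (\<Sum>i\<le>r j. y i) + (1/2) ^ j *\<^sub>R Y"
        using assms(1) by (intro add_increasing scaleR_nonneg_nonneg sum_nonneg) auto
      finally have "z j \<le> sup (P - (1/4) ^ k *\<^sub>R Q) 0"
        unfolding z_def P_def[symmetric] diff_diff_eq by (intro sup_mono diff_left_mono) auto
      also have "P - (1/4) ^ k *\<^sub>R Q = (1/4) ^ k *\<^sub>R (- (Q - 4 ^ k *\<^sub>R P))"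
        by (simp add: algebra_simps flip: power_mult_distrib)
      also have "sup \<dots> 0 = (1/4) ^ k *\<^sub>R sup (- (Q - 4 ^ k *\<^sub>R P)) 0"
        by (simp only: scaleR_sup scaleR_zero_right zero_le_power zero_le_divide_1_iff zero_le_numeral)
      finally have z_j: "z j \<le> (1/4) ^ k *\<^sub>R sup (- (Q - 4 ^ k *\<^sub>R P)) 0" .
      have "inf (1 *\<^sub>R sup (Q - 4 ^ k *\<^sub>R P) 0) ((1/4) ^ k *\<^sub>R sup (- (Q - 4 ^ k *\<^sub>R P)) 0) = 0"
        by (intro disjoint_scaleR inf_sup_minus_eq_0) auto
      then have "inf (z k) (z j) = 0"
        by (intro disjoint_mono[OF z_nonneg z_k z_nonneg z_j])
      then show ?thesis by (simp only: inf_commute)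
    qed
    show ?thesis
      unfolding disjoint_seq_def
      using less z_nonneg by (metis abs_of_nonneg inf_commute linorder_neqE_nat)
  qed
  moreover have "\<exists>n. 0 \<le> z k \<and> z k \<le> y n" for k
  proof (intro exI conjI z_nonneg)
    have "0 \<le> 4 ^ k *\<^sub>R (\<Sum>i\<le>r k. y i) + (1/2) ^ k *\<^sub>R Y"
      using assms(1) Y_nonneg by (intro add_nonneg_nonneg scaleR_nonneg_nonneg sum_nonneg) auto
    then show "z k \<le> y (r (Suc k))"
      unfolding z_def diff_diff_eq using assms(1) by (intro sup_least) (auto simp: diff_le_eq)
  qed
  ultimately have "z \<longlonglongrightarrow> 0" by (rule disj)
  \<comment> \<open>Removing \<open>(1/2) ^ k *\<^sub>R Y\<close> costs at most its norm, which
    prevents \<open>z\<close> from tending to \<open>0\<close>.\<close>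
  moreover have "\<delta> \<le> norm (z k) + (1/2) ^ k * norm Y" for k
  proof -
    define b where "b = y (r (Suc k)) - 4 ^ k *\<^sub>R (\<Sum>i\<le>r k. y i)"
    have "b - (1/2) ^ k *\<^sub>R Y \<le> z k" by (simp add: z_def b_def)
    then have "sup b 0 \<le> z k + (1/2) ^ k *\<^sub>R Y"
      using z_nonneg Y_nonneg
      by (intro sup_least add_nonneg_nonneg scaleR_nonneg_nonneg) (auto simp: diff_le_eq)
    then have "norm (sup b 0) \<le> norm (z k + (1/2) ^ k *\<^sub>R Y)"
      by (intro norm_mono) auto
    also have "\<dots> \<le> norm (z k) + (1/2) ^ k * norm Y"
      by (rule order_trans[OF norm_triangle_ineq]) simp
    finally show ?thesis using r(2)[of k] by (simp add: b_def)
  qed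
  moreover have "(\<lambda>k. (1/2::real) ^ k) \<longlonglongrightarrow> 0"
    by (rule LIMSEQ_power_zero) simp
  ultimately have "(\<lambda>k. norm (z k) + (1/2) ^ k * norm Y) \<longlonglongrightarrow> 0 + 0 * norm Y"
    by (intro tendsto_add tendsto_mult tendsto_const tendsto_norm_zero)
  then have "\<delta> \<le> 0 + 0 * norm Y"
    by (rule tendsto_lowerbound) (use \<open>\<And>k. \<delta> \<le> norm (z k) + (1/2) ^ k * norm Y\<close> in auto)
  with \<open>0 < \<delta>\<close> show False by simp
qed

section \<open>Weakly null sequences in order intervals\<close>

text \<open>Along a sparse subsequence \<open>a\<close>, a functional \<open>\<eta> k\<close>
  norming \<open>a k\<close> takes values adding up to at most \<open>\<delta> / 2\<close> on the
  later terms. With \<open>S k\<close> the limit of the tail sums truncated at \<open>u\<close>,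
  \<open>\<eta> k\<close> is at least \<open>\<delta>\<close> at \<open>S k\<close> and at most
  \<open>\<delta> / 2\<close> at \<open>S (Suc k)\<close>, so the decreasing \<open>S\<close> keeps
  jumping, which is impossible in \<open>[0, u]\<close>.\<close>

lemma weakly_null_in_order_interval_not_bounded_below:
  fixes w :: "nat \<Rightarrow> 'a::banach_lattice"
  assumes "\<And>n. 0 \<le> w n" "\<And>n. w n \<le> u" "0 < \<delta>" "\<And>n. \<delta> \<le> norm (w n)"
    and null: "\<And>\<phi>. 0 \<le> \<phi> \<Longrightarrow> (\<lambda>n. blinfun_apply \<phi> (w n) :: real) \<longlonglongrightarrow> 0"
    and disj: "\<And>e. disjoint_seq e \<Longrightarrow> (\<And>n. 0 \<le> e n \<and> e n \<le> u) \<Longrightarrow> e \<longlonglongrightarrow> 0"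
  shows False
proof -
  have u: "0 \<le> u" using assms(1,2) order_trans by blast
  have "\<exists>f :: 'a \<Rightarrow>\<^sub>L real. 0 \<le> f \<and> norm f \<le> 1 \<and> blinfun_apply f (w n) = norm (w n)" for n
    using positive_norming_functional[OF assms(1)] by blast
  then obtain \<psi> :: "nat \<Rightarrow> 'a \<Rightarrow>\<^sub>L real"
    where \<psi>: "\<And>n. 0 \<le> \<psi> n" "\<And>n. norm (\<psi> n) \<le> 1" "\<And>n. \<psi> n (w n) = norm (w n)"
    by metis
  \<comment> \<open>Only finitely many functionals are involved and each tends to \<open>0\<close>
    along \<open>w\<close>, so a common late index exists.\<close>
  have next_ex: "\<exists>j>M. \<forall>n\<le>M. \<psi> n (w j) \<le> \<epsilon>" if "0 < \<epsilon>" for M \<epsilon>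
  proof -
    have "\<forall>\<^sub>F j in sequentially. \<forall>n\<in>{..M}. \<psi> n (w j) < \<epsilon>"
      using order_tendstoD(2)[OF null[OF \<psi>(1)] that] by (intro eventually_ball_finite) auto
    then have "\<forall>\<^sub>F j in sequentially. j > M \<and> (\<forall>n\<in>{..M}. \<psi> n (w j) < \<epsilon>)"
      using eventually_gt_at_top[of M] by (simp add: eventually_conj)
    then obtain j where "j > M" "\<forall>n\<in>{..M}. \<psi> n (w j) < \<epsilon>"
      using eventually_happens'[OF sequentially_bot] by blast
    then show ?thesis by (intro exI[of _ j]) (auto intro: less_imp_le)
  qed
  \<comment> \<open>The condition on all \<open>n \<le> r m\<close> covers every functional chosen
    earlier. With this exponent, the errors at positions after \<open>k\<close> add up to at most
    \<open>\<delta> * (1/2) ^ Suc k\<close>.\<close>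
  have "\<exists>r. \<forall>m. True \<and> (r m < r (Suc m) \<and> (\<forall>n\<le>r m. \<psi> n (w (r (Suc m))) \<le> \<delta> * (1/2) ^ Suc (Suc m)))"
  proof (intro dependent_nat_choice)
    show "\<exists>j. True \<and> (M < j \<and> (\<forall>n\<le>M. \<psi> n (w j) \<le> \<delta> * (1/2) ^ Suc (Suc m)))" for M m
      using next_ex[of "\<delta> * (1/2) ^ Suc (Suc m)" M] assms(3) by auto
  qed simp
  then obtain r :: "nat \<Rightarrow> nat" where r: "\<And>m. r m < r (Suc m)"
    "\<And>m n. n \<le> r m \<Longrightarrow> \<psi> n (w (r (Suc m))) \<le> \<delta> * (1/2) ^ Suc (Suc m)"
    by blast
  define a where "a m = w (r m)" for m
  define \<eta> where "\<eta> m = \<psi> (r m)" for m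
  have a_nonneg: "0 \<le> a m" and a_le: "a m \<le> u" for m
    using assms(1,2) by (auto simp: a_def)
  have \<eta>_small: "\<eta> k (a m) \<le> \<delta> * (1/2) ^ Suc m" if km: "k < m" for k m
  proof -
    obtain m' where m': "m = Suc m'" using km by (cases m) auto
    have "r k \<le> r m'"
      using r(1) km m' by (simp add: lift_Suc_mono_le less_imp_le)
    then show ?thesis using r(2) by (simp add: m' a_def \<eta>_def)
  qed
  \<comment> \<open>Truncation at \<open>u\<close> replaces a tail series that may diverge:
    \<open>s k\<close> increases inside \<open>[0, u]\<close> and is therefore Cauchy.\<close>
  define s where "s k N = inf u (\<Sum>m\<in>{k..<N}. a m)" for k N
  have s_nonneg: "0 \<le> s k N" and s_le: "s k N \<le> u" for k N
    using u a_nonneg by (auto simp: s_def intro: sum_nonneg)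
  have "Cauchy (s k)" for k
  proof (rule incseq_Cauchy[OF _ s_nonneg s_le disj])
    show "incseq (s k)"
      using a_nonneg by (auto simp: s_def incseq_def intro!: le_infI2 sum_mono2)
  qed
  then have "\<exists>l. s k \<longlonglongrightarrow> l" for k
    by (simp add: Cauchy_convergent_iff convergent_def)
  then obtain S where S: "\<And>k. s k \<longlonglongrightarrow> S k" by metis
  have S_nonneg: "0 \<le> S k" for k
    using S by (rule tendsto_nonneg_banach_lattice) (simp add: s_nonneg)
  have S_le: "S k \<le> u" for k
    using S tendsto_const by (rule tendsto_mono_banach_lattice) (simp add: s_le)
  have S_Suc: "S (Suc k) \<le> S k" for k
    using S S
  proof (rule tendsto_mono_banach_lattice)
    have "s (Suc k) N \<le> s k N" for N
      using a_nonneg by (auto simp: s_def intro!: le_infI2 sum_mono2)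
    then show "\<forall>\<^sub>F N in sequentially. s (Suc k) N \<le> s k N" by simp
  qed
  have a_le_S: "a k \<le> S k" for k
    using tendsto_const S
  proof (rule tendsto_mono_banach_lattice)
    have "a k \<le> s k N" if "k < N" for N
      using sum_mono2[of "{k..<N}" "{k}" a] a_nonneg that a_le by (simp add: s_def)
    then show "\<forall>\<^sub>F N in sequentially. a k \<le> s k N"
      by (intro eventually_mono[OF eventually_gt_at_top[of k]])
  qed
  have geom: "(\<Sum>m\<in>{j..<N}. (1/2::real) ^ Suc m) \<le> (1/2) ^ j" for j N
  proof (cases "j \<le> N")
    case True
    then have "(\<Sum>m\<in>{j..<N}. (1/2::real) ^ Suc m) = (1/2) ^ j - (1/2) ^ N"
      by (induction N rule: dec_induct) auto
    then show ?thesis by simp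
  qed simp
  have \<eta>_S: "\<eta> k (S (Suc k)) \<le> \<delta> / 2" for k
  proof (rule tendsto_upperbound)
    show "(\<lambda>N. \<eta> k (s (Suc k) N)) \<longlonglongrightarrow> \<eta> k (S (Suc k))"
      by (intro tendsto_intros S)
    have "\<eta> k (s (Suc k) N) \<le> \<delta> / 2" for N
    proof -
      have "\<eta> k (s (Suc k) N) \<le> \<eta> k (\<Sum>m\<in>{Suc k..<N}. a m)"
        by (intro positive_blinfun_mono) (auto simp: \<eta>_def \<psi> s_def)
      also have "\<dots> = (\<Sum>m\<in>{Suc k..<N}. \<eta> k (a m))"
        by (rule blinfun.sum_right)
      also have "\<dots> \<le> (\<Sum>m\<in>{Suc k..<N}. \<delta> * (1/2) ^ Suc m)"
        by (intro sum_mono \<eta>_small) auto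
      also have "\<dots> = \<delta> * (\<Sum>m\<in>{Suc k..<N}. (1/2) ^ Suc m)"
        by (rule sum_distrib_left[symmetric])
      also have "\<dots> \<le> \<delta> * (1/2) ^ Suc k"
        using assms(3) by (intro mult_left_mono geom) simp
      also have "\<dots> \<le> \<delta> / 2"
        using assms(3) power_le_one[of "1/2::real" k] by simp
      finally show ?thesis .
    qed
    then show "\<forall>\<^sub>F N in sequentially. \<eta> k (s (Suc k) N) \<le> \<delta> / 2" by simp
  qed simp
  have gap: "\<delta> / 2 \<le> norm (S k - S (Suc k))" for k
  proof -
    have "\<delta> \<le> \<eta> k (S k)"
      using assms(4)[of "r k"] positive_blinfun_mono[OF \<psi>(1) a_le_S, of "r k" k]
      by (simp add: \<eta>_def a_def \<psi>(3))
    then have "\<delta> / 2 \<le> \<eta> k (S k - S (Suc k))"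
      using \<eta>_S[of k] unfolding blinfun.diff_right by linarith
    also have "\<dots> \<le> norm (\<eta> k) * norm (S k - S (Suc k))"
      using norm_blinfun[of "\<eta> k" "S k - S (Suc k)"] by simp
    also have "\<dots> \<le> 1 * norm (S k - S (Suc k))"
      by (intro mult_right_mono) (auto simp: \<eta>_def \<psi>)
    finally show ?thesis by simp
  qed
  \<comment> \<open>Reflection in \<open>u\<close> turns the decreasing \<open>S\<close> into an
    increasing sequence in \<open>[0, u]\<close>.\<close>
  have "(\<lambda>k. (u - S (Suc k)) - (u - S k)) \<longlonglongrightarrow> 0"
  proof (rule incseq_diff_tendsto_zero[OF _ _ _ disj])
    show "incseq (\<lambda>k. u - S k)"
      using S_Suc by (intro incseq_SucI) (simp add: diff_left_mono)
  qed (use S_nonneg S_le in auto)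
  then have "(\<lambda>k. norm (S k - S (Suc k))) \<longlonglongrightarrow> 0"
    by (simp add: tendsto_norm_zero_iff)
  then have "\<delta> / 2 \<le> 0"
    by (rule tendsto_lowerbound) (use gap in auto)
  with assms(3) show False by simp
qed

section \<open>L-weakly compact operators on bounded disjoint sequences\<close>

text \<open>This is the form in which L-weak compactness is applied: division by \<open>R\<close>
  brings the dominating elements \<open>T v\<close> back into the image of the unit ball.\<close>

lemma L_weakly_compact_operator_disjointD:
  fixes T :: "'a::banach_lattice \<Rightarrow>\<^sub>L 'b::banach_lattice"
  assumes "L_weakly_compact_operator T" "0 < R" "disjoint_seq z"
    and dom: "\<And>k. \<exists>v. norm v \<le> R \<and> \<bar>z k\<bar> \<le> \<bar>T v\<bar>"
  shows "z \<longlonglongrightarrow> 0"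
proof -
  define y where "y k = inverse R *\<^sub>R z k" for k
  have abs_y: "\<bar>y k\<bar> = inverse R *\<^sub>R \<bar>z k\<bar>" for k
    using \<open>0 < R\<close> by (simp add: y_def abs_lattice scaleR_sup)
  have "disjoint_seq y"
    using assms(2,3) unfolding disjoint_seq_def abs_y by (auto intro: disjoint_scaleR)
  moreover have "y k \<in> solid_hull (T ` cball 0 1)" for k
  proof -
    obtain v where v: "norm v \<le> R" "\<bar>z k\<bar> \<le> \<bar>T v\<bar>" using dom by blast
    have "\<bar>T (inverse R *\<^sub>R v)\<bar> = inverse R *\<^sub>R \<bar>T v\<bar>"
      using \<open>0 < R\<close> by (simp add: blinfun.scaleR_right abs_lattice scaleR_sup)
    then have "\<bar>y k\<bar> \<le> \<bar>T (inverse R *\<^sub>R v)\<bar>"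
      unfolding abs_y using v(2) \<open>0 < R\<close> by (simp add: scaleR_left_mono)
    moreover have "inverse R *\<^sub>R v \<in> cball 0 1"
      using v(1) \<open>0 < R\<close> by (simp add: field_simps)
    ultimately show ?thesis unfolding solid_hull_def by blast
  qed
  ultimately have "y \<longlonglongrightarrow> 0"
    using assms(1) unfolding L_weakly_compact_operator_def L_weakly_compact_def by blast
  then have "(\<lambda>k. R *\<^sub>R y k) \<longlonglongrightarrow> R *\<^sub>R 0"
    by (intro tendsto_intros)
  then show ?thesis using \<open>0 < R\<close> by (simp add: y_def)
qed

lemma positive_operator_mono:
  fixes T :: "'a::banach_lattice \<Rightarrow>\<^sub>L 'b::banach_lattice"
  assumes "positive_operator T" "x \<le> y"
  shows "T x \<le> T y"
  using assms(1)[unfolded positive_operator_def, rule_format, of "y - x"] assms(2)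
  by (simp add: blinfun.diff_right)

text \<open>If the images have norm at least \<open>\<delta>\<close> along a subsequence, infinitely
  many of them lie up to \<open>\<delta> / 2\<close> below some \<open>u = T v\<close>. Disjoint
  sequences in \<open>[0, u]\<close> are dominated by the single image \<open>T v\<close> and hence
  norm null, while positive functionals tend to \<open>0\<close> along the truncations at
  \<open>u\<close>; these cannot stay bounded below in norm.\<close>

lemma L_weakly_compact_operator_disjoint_norm_null:
  fixes T :: "'a::banach_lattice \<Rightarrow>\<^sub>L 'b::banach_lattice"
  assumes oc: "order_continuous_norm TYPE('a \<Rightarrow>\<^sub>L real)"
    and pos: "positive_operator T" and lwc: "L_weakly_compact_operator T"
    and x: "disjoint_seq x" "\<And>n. 0 \<le> x n" "\<And>n. norm (x n) \<le> K" "0 < K"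
  shows "(\<lambda>n. T (x n)) \<longlonglongrightarrow> 0"
proof (rule ccontr)
  assume "\<not> (\<lambda>n. T (x n)) \<longlonglongrightarrow> 0"
  then obtain \<delta> where \<delta>: "0 < \<delta>" "\<And>M. \<exists>n\<ge>M. \<delta> \<le> norm (T (x n))"
    unfolding LIMSEQ_iff by (auto simp: not_less)
  then have "infinite {n. \<delta> \<le> norm (T (x n))}"
    unfolding infinite_nat_iff_unbounded_le by auto
  then obtain r :: "nat \<Rightarrow> nat" where r: "strict_mono r" "\<And>n. \<delta> \<le> norm (T (x (r n)))"
    using infinite_enumerate by blast
  define y where "y n = T (x (r n))" for n
  have y_nonneg: "0 \<le> y n" for n
    using pos x(2) by (simp add: y_def positive_operator_def)
  obtain c N where cN: "0 \<le> c" "infinite {n. norm (sup (y n - c *\<^sub>R (\<Sum>i\<le>N. y i)) 0) \<le> \<delta> / 2}"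
  proof (rule infinite_almost_dominated[OF y_nonneg])
    show "norm (y n) \<le> norm T * K" for n
      unfolding y_def by (rule order_trans[OF norm_blinfun]) (intro mult_left_mono x(3) norm_ge_zero)
    show "0 < \<delta> / 2" using \<delta> by simp
    fix z assume z: "disjoint_seq z" "\<And>k. \<exists>n. 0 \<le> z k \<and> z k \<le> y n"
    show "z \<longlonglongrightarrow> 0"
    proof (rule L_weakly_compact_operator_disjointD[OF lwc x(4) z(1)])
      fix k
      obtain n where "0 \<le> z k" "z k \<le> y n" using z(2) by blast
      then show "\<exists>v. norm v \<le> K \<and> \<bar>z k\<bar> \<le> \<bar>T v\<bar>"
        using x(3)[of "r n"] y_nonneg[of n] by (intro exI[of _ "x (r n)"]) (simp add: y_def)
    qed
  qed
  define u where "u = c *\<^sub>R (\<Sum>i\<le>N. y i)"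
  define v where "v = c *\<^sub>R (\<Sum>i\<le>N. x (r i))"
  have u: "u = T v"
    by (simp add: u_def v_def y_def blinfun.scaleR_right blinfun.sum_right)
  have u_nonneg: "0 \<le> u"
    using cN(1) y_nonneg by (auto simp: u_def intro: scaleR_nonneg_nonneg sum_nonneg)
  obtain q :: "nat \<Rightarrow> nat" where q: "strict_mono q" "\<And>n. norm (sup (y (q n) - u) 0) \<le> \<delta> / 2"
    using infinite_enumerate[OF cN(2)] unfolding u_def by blast
  define w where "w n = inf (y (q n)) u" for n
  show False
  proof (rule weakly_null_in_order_interval_not_bounded_below[of w u "\<delta> / 2"])
    show "0 \<le> w n" "w n \<le> u" for n
      using y_nonneg u_nonneg by (auto simp: w_def)
    show "0 < \<delta> / 2" using \<delta> by simp
    \<comment> \<open>The part of \<open>y (q n)\<close> above \<open>u\<close> has norm at most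
      \<open>\<delta> / 2\<close>, so the truncation retains the rest.\<close>
    show "\<delta> / 2 \<le> norm (w n)" for n
    proof -
      have "y (q n) = w n + sup (y (q n) - u) 0"
      proof -
        have "sup (y (q n) - u) 0 + u = sup (y (q n)) u"
          by (simp add: add_sup_distrib_right)
        then have "y (q n) + u = w n + sup (y (q n) - u) 0 + u"
          unfolding w_def add_eq_inf_sup[of "y (q n)" u] by (metis add.assoc add.commute)
        then show ?thesis by (simp only: add_right_cancel)
      qed
      then have "norm (y (q n)) \<le> norm (w n) + norm (sup (y (q n) - u) 0)"
        by (metis norm_triangle_ineq)
      then show ?thesis
        using q(2)[of n] r(2)[of "q n"] by (simp add: y_def)
    qed
    show "(\<lambda>n. \<phi> (w n)) \<longlonglongrightarrow> 0" if "0 \<le> \<phi>" for \<phi> :: "'b \<Rightarrow>\<^sub>L real"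
    proof -
      \<comment> \<open>Composition with \<open>T\<close> moves the functional to the domain, whose
        dual has the order continuous norm.\<close>
      have "0 \<le> \<phi> o\<^sub>L T"
        using pos positive_blinfun_nonneg[OF that]
        by (simp add: less_eq_blinfun_def positive_operator_def)
      then have "(\<lambda>n. (\<phi> o\<^sub>L T) (x n)) \<longlonglongrightarrow> 0"
        using x by (intro disjoint_seq_positive_functional_tendsto_zero[OF oc])
      then have "((\<lambda>n. (\<phi> o\<^sub>L T) (x n)) \<circ> (r \<circ> q)) \<longlonglongrightarrow> 0"
        using r(1) q(1) by (intro LIMSEQ_subseq_LIMSEQ strict_mono_o)
      then have "(\<lambda>n. \<phi> (y (q n))) \<longlonglongrightarrow> 0"
        by (simp add: o_def y_def)
      then show ?thesis
        by (rule tendsto_sandwich[OF _ _ tendsto_const, rotated 2])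
          (use u_nonneg y_nonneg in \<open>auto simp: w_def intro!: always_eventually
            positive_blinfun_nonneg[OF that] positive_blinfun_mono[OF that]\<close>)
    qed
    show "e \<longlonglongrightarrow> 0" if e: "disjoint_seq e" "\<And>n. 0 \<le> e n \<and> e n \<le> u" for e
    proof (rule L_weakly_compact_operator_disjointD[OF lwc _ e(1)])
      \<comment> \<open>\<open>norm v\<close> may be \<open>0\<close>, while the radius has to be
        positive.\<close>
      show "0 < norm v + 1" by (simp add: add_nonneg_pos)
      show "\<exists>v'. norm v' \<le> norm v + 1 \<and> \<bar>e k\<bar> \<le> \<bar>T v'\<bar>" for k
        using e(2)[of k] u_nonneg by (intro exI[of _ v]) (simp flip: u)
    qed
  qed
qed

theorem proposition3p10:
  fixes T :: "'a::banach_lattice \<Rightarrow>\<^sub>L 'b::banach_lattice"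
  assumes "order_continuous_norm TYPE('a \<Rightarrow>\<^sub>L real)"
    and "positive_operator T"
    and "L_weakly_compact_operator T"
  shows "disjoint_weak_star_Dunford_Pettis T"
  unfolding disjoint_weak_star_Dunford_Pettis_def
proof (intro allI impI, elim conjE)
  fix x :: "nat \<Rightarrow> 'a" and f :: "nat \<Rightarrow> 'b \<Rightarrow>\<^sub>L real"
  assume "bounded (range x)" "disjoint_seq x" "weak_star_null f"
  obtain C where C: "0 < C" "\<And>n. norm (x n) \<le> C"
    using \<open>bounded (range x)\<close> by (auto simp: bounded_pos)
  obtain K where K: "\<And>n. norm (f n) \<le> K"
    using weak_star_null_norm_bounded[OF \<open>weak_star_null f\<close>] by blast
  \<comment> \<open>Absolute values stay disjoint and keep their norms. Positivity of
    \<open>T\<close> gives \<open>\<bar>T (x n)\<bar> \<le> T \<bar>x n\<bar>\<close>, which carries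
    the convergence back to \<open>x\<close>.\<close>
  have "(\<lambda>n. T \<bar>x n\<bar>) \<longlonglongrightarrow> 0"
    by (rule L_weakly_compact_operator_disjoint_norm_null[OF assms])
      (use \<open>disjoint_seq x\<close> C in \<open>auto simp: disjoint_seq_def\<close>)
  then have lim: "(\<lambda>n. norm (T \<bar>x n\<bar>) * K) \<longlonglongrightarrow> 0"
    by (intro tendsto_mult_left_zero tendsto_norm_zero)
  have "norm (f n (T (x n))) \<le> norm (T \<bar>x n\<bar>) * K" for n
  proof -
    have "T (x n) \<le> T \<bar>x n\<bar>" "- T (x n) \<le> T \<bar>x n\<bar>"
      using positive_operator_mono[OF assms(2) abs_ge_self[of "x n"]]
        positive_operator_mono[OF assms(2) abs_ge_minus_self[of "x n"]]
      by (simp_all add: blinfun.minus_right)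
    then have "\<bar>T (x n)\<bar> \<le> \<bar>T \<bar>x n\<bar>\<bar>"
      by (intro order_trans[OF abs_leI abs_ge_self])
    then have "norm (T (x n)) \<le> norm (T \<bar>x n\<bar>)"
      by (rule norm_mono_abs)
    then have "norm (f n) * norm (T (x n)) \<le> K * norm (T \<bar>x n\<bar>)"
      using K by (intro mult_mono) (auto intro: order_trans[OF norm_ge_zero])
    then show ?thesis
      using norm_blinfun[of "f n" "T (x n)"] by (simp add: mult.commute)
  qed
  then show "(\<lambda>n. f n (T (x n))) \<longlonglongrightarrow> 0"
    by (intro Lim_null_comparison[OF _ lim] always_eventually) auto
qed

end
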